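(* Let $n$ and $m$ be positive integers. If $m$ orthoconvex curves, each with at most two inner corners, cover the $n\times n$ grid $[n]\times[n]\subset\mathbb{R}^2$, then $m\geq 2n/7$.
   Context: $[n]=\{1,2,\ldots,n\}$. A curve covers a point if the point lies on the curve; a collection of curves covers a point set if every point of the set lies on at least one curve of the collection. A set $K\subseteq\mathbb{R}^2$ is orthogonally convex if, for every line $\ell$ parallel to $(1,0)$ or $(0,1)$, the intersection $K\cap\ell$ is empty, a point, or a single segment. The orthogonal convex hull of a point set in $\mathbb{R}^2$ is the intersection of all connected orthogonally convex supersets of it. An orthoconvex curve is a rectilinear curve (consisting of finitely many horizontal and vertical segments) that is the boundary of the orthogonal convex hull of a set of points and is a simple closed curve. All interior angles of such a curve at its corners are 90 or 270 degrees; an inner corner is a corner at which the interior angle is 270 degrees. Different curves need not have the same size. *)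

theory Defs
  imports "HOL-Analysis.Analysis"
begin

type_synonym point = "real \<times> real"

text \<open>A single point is the degenerate segment \<open>closed_segment a a\<close>.\<close>

definition empty_or_segment :: "point set \<Rightarrow> bool" where
  "empty_or_segment S \<longleftrightarrow> S = {} \<or> (\<exists>a b. S = closed_segment a b)"

definition orthogonally_convex :: "point set \<Rightarrow> bool" where
  "orthogonally_convex K \<longleftrightarrow>
     (\<forall>c. empty_or_segment (K \<inter> {p. snd p = c}) \<and> empty_or_segment (K \<inter> {p. fst p = c}))"

text \<open>
  The hull is the intersection of all connected orthogonally convex supersets. It need not
  itself be connected, e.g. for two points in general position.
\<close>

definition orthogonal_convex_hull :: "point set \<Rightarrow> point set" where
  "orthogonal_convex_hull X = (\<lambda>K. connected K \<and> orthogonally_convex K) hull X"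

definition rectilinear :: "point set \<Rightarrow> bool" where
  "rectilinear C \<longleftrightarrow>
     (\<exists>\<S>. finite \<S> \<and> C = \<Union>\<S> \<and>
        (\<forall>s\<in>\<S>. \<exists>a b. s = closed_segment a b \<and> (fst a = fst b \<or> snd a = snd b)))"

definition simple_closed_curve :: "point set \<Rightarrow> bool" where
  "simple_closed_curve C \<longleftrightarrow>
     (\<exists>g. simple_path g \<and> pathfinish g = pathstart g \<and> path_image g = C)"

definition orthoconvex_curve :: "point set \<Rightarrow> bool" where
  "orthoconvex_curve C \<longleftrightarrow>
     rectilinear C \<and> simple_closed_curve C \<and> (\<exists>X. C = frontier (orthogonal_convex_hull X))"

text \<open>A corner is a point at which a horizontal and a vertical segment of the curve meet.\<close>

definition corner :: "point set \<Rightarrow> point \<Rightarrow> bool" where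
  "corner C p \<longleftrightarrow>
     (\<exists>a b. a \<noteq> p \<and> snd a = snd p \<and> closed_segment p a \<subseteq> C \<and>
            b \<noteq> p \<and> fst b = fst p \<and> closed_segment p b \<subseteq> C)"

text \<open>
  The interior angle, in radians, is the total measure of the directions in which one enters
  the region enclosed by the curve when leaving \<open>p\<close>.
\<close>

definition interior_angle :: "point set \<Rightarrow> point \<Rightarrow> real" where
  "interior_angle C p =
     measure lebesgue {\<theta> \<in> {0..<2 * pi}.
       \<forall>\<^sub>F t in at_right 0. p + t *\<^sub>R (cos \<theta>, sin \<theta>) \<in> inside C}"

definition inner_corners :: "point set \<Rightarrow> point set" where
  "inner_corners C = {p. corner C p \<and> interior_angle C p = 3 * pi / 2}"

definition grid :: "nat \<Rightarrow> point set" where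
  "grid n = (real ` {1..n}) \<times> (real ` {1..n})"

definition covers :: "point set set \<Rightarrow> point set \<Rightarrow> bool" where
  "covers \<C> X \<longleftrightarrow> (\<forall>p\<in>X. \<exists>C\<in>\<C>. p \<in> C)"

end

theory Submission imports Defs begin

text \<open>
  The region \<open>U\<close> enclosed by an orthoconvex curve is open and connected and meets every line
  parallel to an axis in an interval. If the curve has a horizontal segment at a height at which
  it is neither topmost nor bottommost, the row of \<open>U\<close> at this height ends in an inner corner.
  So the horizontal segments of each curve lie on at most four levels: top, bottom and two more.

  Suppose \<open>7 m < 2 n\<close>. A curve without horizontal segment in a row covers at most two points of
  that row, so each of the \<open>n\<close> rows carries a horizontal segment, and at least \<open>c = n - 2 m\<close> rows
  are the top or the bottom level of some curve. Having so many different top and bottom levels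
  makes the sum of the numbers of rows met by the regions small, at most
  \<open>m n - (c\<^sup>2 + 2 c) / 4\<close>; the same holds for columns. A curve whose region meets \<open>h\<close> rows and
  \<open>w\<close> columns covers at most \<open>2 h + 2 w + 4\<close> points, and counting all \<open>n\<^sup>2\<close> points yields
  \<open>c\<^sup>2 + c \<le> 2 m\<^sup>2 + 2 m\<close>, which contradicts \<open>3 m < 2 c\<close>.
\<close>

section \<open>The region enclosed by an orthoconvex curve\<close>

text \<open>\<open>W\<close> lies in a single component of the complement, which is therefore
  unbounded. A component that meets \<open>V\<close> cannot also meet \<open>W\<close>, as both sets
  are open and disjoint, so it stays inside the bounded set \<open>V\<close>.\<close>

lemma inside_eqI:
  fixes C V W :: "'a::real_normed_vector set"
  assumes "open V" "open W" "connected W" "V \<inter> W = {}" "V \<union> W = - C" "bounded V" "\<not> bounded W"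
  shows "inside C = V"
proof (intro set_eqI iffI)
  fix x assume x: "x \<in> inside C"
  show "x \<in> V"
  proof (rule ccontr)
    assume "x \<notin> V"
    with x have "x \<in> W" using assms(5) by (auto simp: inside_def)
    then have "W \<subseteq> connected_component_set (- C) x"
      using assms by (intro connected_component_maximal) auto
    with x assms(7) show False by (auto simp: inside_def intro: bounded_subset)
  qed
next
  fix x assume x: "x \<in> V"
  let ?K = "connected_component_set (- C) x"
  have "V \<inter> ?K = {} \<or> W \<inter> ?K = {}"
    using assms connected_component_subset[of "- C" x]
    by (intro connectedD[OF connected_connected_component]) auto
  moreover have "x \<in> ?K" using x assms(5) by auto
  ultimately have "?K \<subseteq> V"
    using x assms(5) connected_component_subset[of "- C" x] by blast
  then show "x \<in> inside C"
    using x assms by (auto simp: inside_def intro: bounded_subset)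
qed

text \<open>The Jordan curve theorem for curves in \<open>complex\<close> is carried over by the
  linear bijection \<open>h\<close> and its inverse \<open>f\<close>. The images of the two
  components are recognised as inside and outside by \<open>inside_eqI\<close>.\<close>

lemma Jordan_inside_outside_plane:
  fixes C :: "point set"
  assumes "simple_closed_curve C"
  shows "compact C" "inside C \<noteq> {}" "open (inside C)" "connected (inside C)"
    "open (outside C)" "connected (outside C)" "bounded (inside C)" "\<not> bounded (outside C)"
    "frontier (inside C) = C"
proof -
  obtain g where g: "simple_path g" "pathfinish g = pathstart g" "path_image g = C"
    using assms by (auto simp: simple_closed_curve_def)
  define f where "f = (\<lambda>p::point. Complex (fst p) (snd p))"
  define h where "h = (\<lambda>z. (Re z, Im z))"
  have lf: "linear f"
    by (auto simp: f_def linear_iff complex_eq_iff)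
  have lh: "linear h"
    by (auto simp: h_def linear_iff)
  have hf: "h (f p) = p" and fh: "f (h z) = z" for p z
    by (auto simp: h_def f_def complex_eq_iff)
  have bf: "bij f" and bh: "bij h"
    using hf fh by (auto intro: bij_betw_byWitness[where f'=h] bij_betw_byWitness[where f'=f])
  have inj: "inj h" "surj h" using bh by (auto simp: bij_def)
  let ?D = "path_image (f \<circ> g)"
  have D: "h ` ?D = C"
    using g hf by (auto simp: path_image_compose image_image)
  have sp: "simple_path (f \<circ> g)" "pathfinish (f \<circ> g) = pathstart (f \<circ> g)"
    using g lf bf by (auto simp: simple_path_linear_image_eq bij_def pathfinish_compose pathstart_compose)
  note J = Jordan_inside_outside[OF sp]
  show "compact C" using g compact_simple_path_image by blast
  define V where "V = h ` inside ?D"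
  define W where "W = h ` outside ?D"
  have oV: "open V" "open W"
    using J lh inj by (auto simp: V_def W_def open_surjective_linear_image)
  have cV: "connected V" "connected W"
    using J lh by (auto simp: V_def W_def connected_linear_image)
  have VW: "V \<inter> W = {}"
    using J image_Int[OF inj(1), of "inside ?D" "outside ?D"] by (simp add: V_def W_def)
  have "V \<union> W = h ` (- ?D)"
    using J by (metis V_def W_def image_Un)
  also have "\<dots> = - C"
    using bij_image_Compl_eq[OF bh] D by auto
  finally have U: "V \<union> W = - C" .
  have bV: "bounded V"
    using J lh by (auto simp: V_def bounded_linear_image linear_conv_bounded_linear)
  have "outside ?D = f ` W" by (auto simp: W_def image_image fh)
  then have bW: "\<not> bounded W"
    using J lf bounded_linear_image linear_conv_bounded_linear by metis
  have I: "inside C = V"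
    using oV cV VW U bV bW by (intro inside_eqI) auto
  have O: "outside C = W"
    using I U VW inside_Un_outside[of C] inside_Int_outside[of C] by blast
  show "inside C \<noteq> {}" "open (inside C)" "connected (inside C)"
    "open (outside C)" "connected (outside C)" "bounded (inside C)" "\<not> bounded (outside C)"
    using J I O oV cV bV bW by (auto simp: V_def)
  have "frontier V = h ` frontier (inside ?D)"
    unfolding frontier_def V_def
    using closure_injective_linear_image[OF lh inj(1)] interior_bijective_linear_image[OF lh bh]
    by (simp add: image_set_diff[OF inj(1)])
  moreover have "frontier (inside ?D) = ?D" using J by blast
  ultimately show "frontier (inside C) = C"
    using I D by metis
qed

section \<open>Line-convex sets and the local shape of rectilinear curves\<close>

text \<open>Unlike in \<open>orthogonally_convex\<close>, the sections may be open intervals, so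
  that the notion applies to the open region enclosed by a curve.\<close>

definition line_convex :: "point set \<Rightarrow> bool" where
  "line_convex U \<longleftrightarrow> (\<forall>y. is_interval {x. (x, y) \<in> U}) \<and> (\<forall>x. is_interval {y. (x, y) \<in> U})"

lemma line_convex_row:
  "line_convex U \<Longrightarrow> (a, y) \<in> U \<Longrightarrow> (b, y) \<in> U \<Longrightarrow> a \<le> x \<Longrightarrow> x \<le> b \<Longrightarrow> (x, y) \<in> U"
  using mem_is_interval_1_I[of "{x. (x, y) \<in> U}" a b x] by (simp add: line_convex_def)

lemma line_convex_column:
  "line_convex U \<Longrightarrow> (x, a) \<in> U \<Longrightarrow> (x, b) \<in> U \<Longrightarrow> a \<le> y \<Longrightarrow> y \<le> b \<Longrightarrow> (x, y) \<in> U"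
  using mem_is_interval_1_I[of "{y. (x, y) \<in> U}" a b y] by (simp add: line_convex_def)

text \<open>Near each of its points the set stays on the horizontal and the vertical line through
  that point. This is the form in which rectilinearity enters the search for inner corners; it is
  symmetric in the two coordinates.\<close>

definition locally_cross :: "point set \<Rightarrow> bool" where
  "locally_cross C \<longleftrightarrow>
     (\<forall>p\<in>C. \<exists>\<epsilon>>0. \<forall>q\<in>C. dist q p < \<epsilon> \<longrightarrow> fst q = fst p \<or> snd q = snd p)"

text \<open>The finitely many segments that miss \<open>p\<close> form a closed set, so close to
  \<open>p\<close> only segments through \<open>p\<close> occur. \<open>H\<close> collects the
  heights of horizontal segments; at any other height the curve is locally vertical.\<close>

lemma rectilinear_locally:
  assumes "rectilinear C"
  obtains H where "finite H"
    "\<And>p. p \<in> C \<Longrightarrow> \<exists>\<epsilon>>0. \<forall>q\<in>C. dist q p < \<epsilon> \<longrightarrow> fst q = fst p \<or> snd p \<in> H \<and> snd q = snd p"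
proof -
  obtain S where S: "finite S" "C = \<Union>S"
    and seg: "\<forall>s\<in>S. \<exists>a b. s = closed_segment a b \<and> (fst a = fst b \<or> snd a = snd b)"
    using assms unfolding rectilinear_def by (elim exE conjE)
  define H where "H = {y. \<exists>s\<in>S. s \<noteq> {} \<and> snd ` s = {y}}"
  have const: "snd ` closed_segment a b = {snd a}" if "snd a = snd b" for a b :: point
    using that closed_segment_linear_image[OF linear_snd, of a b] by simp
  have constf: "fst ` closed_segment a b = {fst a}" if "fst a = fst b" for a b :: point
    using that closed_segment_linear_image[OF linear_fst, of a b] by simp
  have "H \<subseteq> (\<lambda>s. the_elem (snd ` s)) ` S"
    unfolding H_def by (smt (verit) image_iff mem_Collect_eq subsetI the_elem_eq)
  then have "finite H" using S finite_surj by blast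
  moreover have "\<exists>\<epsilon>>0. \<forall>q\<in>C. dist q p < \<epsilon> \<longrightarrow> fst q = fst p \<or> snd p \<in> H \<and> snd q = snd p"
    if p: "p \<in> C" for p
  proof -
    have "closed (\<Union>{s\<in>S. p \<notin> s})"
      using S seg closed_segment by (intro closed_Union) fastforce+
    then have "open (- \<Union>{s\<in>S. p \<notin> s})" by auto
    then obtain e where e: "e > 0" "ball p e \<subseteq> - \<Union>{s\<in>S. p \<notin> s}"
      by (metis (no_types, lifting) ComplI UnionE mem_Collect_eq open_contains_ball)
    show ?thesis
    proof (intro exI conjI ballI impI)
      fix q assume q: "q \<in> C" "dist q p < e"
      then have "q \<in> ball p e" by (simp add: dist_commute)
      then obtain s where s: "s \<in> S" "q \<in> s" "p \<in> s" using S q e by blast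
      obtain a b where ab: "s = closed_segment a b" "fst a = fst b \<or> snd a = snd b"
        using seg s(1) by blast
      show "fst q = fst p \<or> snd p \<in> H \<and> snd q = snd p"
        using ab(2)
      proof
        assume "fst a = fst b"
        then show ?thesis using constf s ab by blast
      next
        assume "snd a = snd b"
        then have "snd ` s = {snd a}" using const ab by auto
        moreover from this have "snd q = snd a" "snd p = snd a" using s by blast+
        ultimately show ?thesis using s by (auto simp: H_def)
      qed
    qed (use e in auto)
  qed
  ultimately show ?thesis using that by blast
qed

lemma rectilinear_locally_cross: "rectilinear C \<Longrightarrow> locally_cross C"
  unfolding locally_cross_def by (erule rectilinear_locally) blast

section \<open>From the orthogonal convex hull to the enclosed region\<close>

lemma empty_or_segment_compact_convex:
  "empty_or_segment S \<Longrightarrow> compact S \<and> convex S"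
  by (auto simp: empty_or_segment_def)

text \<open>A section of the hull is the intersection of the sections of the supersets, each of
  which is compact and convex. Without any admissible superset the hull would be
  \<open>UNIV\<close>, so the hypothesis makes this family nonempty.\<close>

lemma orthogonal_convex_hull_line:
  assumes "orthogonal_convex_hull X \<noteq> UNIV"
  shows "compact (orthogonal_convex_hull X \<inter> {p. snd p = c})"
    "compact (orthogonal_convex_hull X \<inter> {p. fst p = c})"
    "convex (orthogonal_convex_hull X \<inter> {p. snd p = c})"
    "convex (orthogonal_convex_hull X \<inter> {p. fst p = c})"
proof -
  let ?F = "{K. (connected K \<and> orthogonally_convex K) \<and> X \<subseteq> K}"
  have ne: "?F \<noteq> {}" using assms by (auto simp: orthogonal_convex_hull_def hull_def)
  have eq: "orthogonal_convex_hull X \<inter> L = \<Inter>((\<lambda>K. K \<inter> L) ` ?F)" for L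
    using ne by (auto simp: orthogonal_convex_hull_def hull_def)
  have 1: "compact (K \<inter> {p. snd p = c}) \<and> convex (K \<inter> {p. snd p = c})"
          "compact (K \<inter> {p. fst p = c}) \<and> convex (K \<inter> {p. fst p = c})" if "K \<in> ?F" for K
    using that empty_or_segment_compact_convex by (auto simp: orthogonally_convex_def)
  have cc: "compact (orthogonal_convex_hull X \<inter> L) \<and> convex (orthogonal_convex_hull X \<inter> L)"
    if L: "\<And>K. K \<in> ?F \<Longrightarrow> compact (K \<inter> L) \<and> convex (K \<inter> L)" for L
    unfolding eq
  proof
    show "compact (\<Inter>((\<lambda>K. K \<inter> L) ` ?F))"
      by (rule compact_Inter) (use L ne in blast)+
    show "convex (\<Inter>((\<lambda>K. K \<inter> L) ` ?F))"
      by (rule convex_Inter) (use L in blast)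
  qed
  show "compact (orthogonal_convex_hull X \<inter> {p. snd p = c})"
    "compact (orthogonal_convex_hull X \<inter> {p. fst p = c})"
    "convex (orthogonal_convex_hull X \<inter> {p. snd p = c})"
    "convex (orthogonal_convex_hull X \<inter> {p. fst p = c})"
    using 1 cc by blast+
qed

lemma orthogonal_convex_hull_line_convex:
  assumes "orthogonal_convex_hull X \<noteq> UNIV"
  shows "line_convex (orthogonal_convex_hull X)"
proof -
  let ?K = "orthogonal_convex_hull X"
  have "{x. (x, c) \<in> ?K} = fst ` (?K \<inter> {p. snd p = c})" for c by force
  moreover have "{y. (c, y) \<in> ?K} = snd ` (?K \<inter> {p. fst p = c})" for c by force
  ultimately show ?thesis
    unfolding line_convex_def is_interval_convex_1
    using orthogonal_convex_hull_line[OF assms] convex_linear_image linear_fst linear_snd by metis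
qed

text \<open>A small ball around the middle point, translated along the line, fits into the balls
  around both end points. Each of its points then lies between two points of \<open>K\<close> on a
  common line.\<close>

lemma line_convex_interior:
  assumes "line_convex K"
  shows "line_convex (interior K)"
proof -
  have 1: "(x, y) \<in> interior K" if ab: "(a, y) \<in> interior K" "(b, y) \<in> interior K" and x: "a \<le> x" "x \<le> b"
    for a b x y
  proof -
    obtain e1 e2 where e: "e1 > 0" "ball (a, y) e1 \<subseteq> K" "e2 > 0" "ball (b, y) e2 \<subseteq> K"
      using ab unfolding mem_interior by blast
    have "ball (x, y) (min e1 e2) \<subseteq> K"
    proof
      fix q assume q: "q \<in> ball (x, y) (min e1 e2)"
      obtain u v where [simp]: "q = (u, v)" by (cases q)
      have "(u + (a - x), v) \<in> K"
        using q by (intro subsetD[OF e(2)]) (auto simp: dist_Pair_Pair dist_real_def)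
      moreover have "(u + (b - x), v) \<in> K"
        using q by (intro subsetD[OF e(4)]) (auto simp: dist_Pair_Pair dist_real_def)
      ultimately show "q \<in> K"
        using line_convex_row[OF assms, of "u + (a - x)" v "u + (b - x)" u] x by simp
    qed
    then show ?thesis using e unfolding mem_interior by (metis min_less_iff_conj)
  qed
  have 2: "(x, y) \<in> interior K" if ab: "(x, a) \<in> interior K" "(x, b) \<in> interior K" and y: "a \<le> y" "y \<le> b"
    for a b x y
  proof -
    obtain e1 e2 where e: "e1 > 0" "ball (x, a) e1 \<subseteq> K" "e2 > 0" "ball (x, b) e2 \<subseteq> K"
      using ab unfolding mem_interior by blast
    have "ball (x, y) (min e1 e2) \<subseteq> K"
    proof
      fix q assume q: "q \<in> ball (x, y) (min e1 e2)"
      obtain u v where [simp]: "q = (u, v)" by (cases q)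
      have "(u, v + (a - y)) \<in> K"
        using q by (intro subsetD[OF e(2)]) (auto simp: dist_Pair_Pair dist_real_def)
      moreover have "(u, v + (b - y)) \<in> K"
        using q by (intro subsetD[OF e(4)]) (auto simp: dist_Pair_Pair dist_real_def)
      ultimately show "q \<in> K"
        using line_convex_column[OF assms, of u "v + (a - y)" "v + (b - y)" v] y by simp
    qed
    then show ?thesis using e unfolding mem_interior by (metis min_less_iff_conj)
  qed
  show ?thesis
    unfolding line_convex_def is_interval_1 using 1 2 by blast
qed

text \<open>Inside and outside are connected and avoid the frontier of the hull \<open>K\<close>, so
  each is contained in \<open>K\<close> or disjoint from it. The outside is disjoint from
  \<open>K\<close>. If the inside is contained in \<open>K\<close>, it equals
  \<open>interior K\<close>. Otherwise \<open>K\<close> would be a subset of the curve, and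
  row-convexity of \<open>K\<close> would still force a point of the inside into
  \<open>K\<close>.\<close>

lemma orthoconvex_curve_line_convex_inside:
  assumes "orthoconvex_curve C"
  shows "line_convex (inside C)"
proof -
  have scc: "simple_closed_curve C" and rect: "rectilinear C"
    using assms by (auto simp: orthoconvex_curve_def)
  note J = Jordan_inside_outside_plane[OF scc]
  obtain X where "C = frontier (orthogonal_convex_hull X)"
    using assms by (auto simp: orthoconvex_curve_def)
  define K where "K = orthogonal_convex_hull X"
  have C: "C = frontier K" by (simp add: K_def \<open>C = _\<close>)
  have "C \<noteq> {}" using J(2,8) by (auto simp: inside_empty)
  then have KU: "orthogonal_convex_hull X \<noteq> UNIV" using C K_def by auto
  have Kc: "line_convex K" using orthogonal_convex_hull_line_convex[OF KU] by (simp add: K_def)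
  note Kl = orthogonal_convex_hull_line[OF KU, folded K_def]
  have dich: "S \<subseteq> K \<or> S \<inter> K = {}" if "connected S" "S \<inter> C = {}" for S
    using connected_Int_frontier[OF that(1), of K] that(2) C by blast
  \<comment> \<open>Otherwise a whole row far above the curve would belong to \<open>K\<close>,
    whose rows are bounded.\<close>
  have out: "outside C \<inter> K = {}"
  proof (rule ccontr)
    assume "outside C \<inter> K \<noteq> {}"
    then have oK: "outside C \<subseteq> K" using dich[of "outside C"] J(6) outside_no_overlap by blast
    have "bounded (C \<union> inside C)" using J compact_imp_bounded by auto
    then obtain M where M: "\<And>p. p \<in> C \<union> inside C \<Longrightarrow> norm p \<le> M" by (meson bounded_iff)
    have inK: "(x, \<bar>M\<bar> + 1) \<in> K" for x
    proof -
      have "norm (x, \<bar>M\<bar> + 1) > M"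
        using norm_snd_le[of "\<bar>M\<bar> + 1" x] by simp
      then have "(x, \<bar>M\<bar> + 1) \<notin> C \<union> inside C" using M by fastforce
      then show ?thesis using oK inside_Un_outside[of C] by blast
    qed
    obtain N where N: "\<And>p. p \<in> K \<inter> {p. snd p = \<bar>M\<bar> + 1} \<Longrightarrow> norm p \<le> N"
      using compact_imp_bounded[OF Kl(1)] by (meson bounded_iff)
    show False
      using N[of "(\<bar>N\<bar> + 1, \<bar>M\<bar> + 1)"] inK norm_fst_le[of "\<bar>N\<bar> + 1" "\<bar>M\<bar> + 1"] by simp
  qed
  show ?thesis
  proof (cases "inside C \<subseteq> K")
    case True
    have "interior K \<inter> C = {}" unfolding C frontier_def by blast
    then have "interior K \<subseteq> inside C"
      using out interior_subset[of K] inside_Un_outside[of C] by blast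
    then have "inside C = interior K"
      using True J(3) by (simp add: interior_maximal subset_antisym)
    then show ?thesis using line_convex_interior[OF Kc] by simp
  next
    case False
    then have "inside C \<inter> K = {}" using dich[of "inside C"] J(4) inside_no_overlap by blast
    then have KC: "K \<subseteq> C" using out inside_Un_outside[of C] by blast
    obtain H where H: "finite H"
      "\<And>p. p \<in> C \<Longrightarrow> \<exists>\<epsilon>>0. \<forall>q\<in>C. dist q p < \<epsilon> \<longrightarrow> fst q = fst p \<or> snd p \<in> H \<and> snd q = snd p"
      using rectilinear_locally[OF rect] by blast
    \<comment> \<open>Near such a point the curve is vertical, so \<open>K\<close>, which is dense in it and closed on
      vertical lines, contains the point.\<close>
    have inK: "(c, y) \<in> K" if c: "(c, y) \<in> C" and y: "y \<notin> H" for c y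
    proof (rule ccontr)
      assume "(c, y) \<notin> K"
      then have "(c, y) \<in> - (K \<inter> {p. fst p = c})" by auto
      moreover have "open (- (K \<inter> {p. fst p = c}))"
        using compact_imp_closed[OF Kl(2)] open_Compl by blast
      ultimately obtain d where d: "d > 0" "ball (c, y) d \<subseteq> - (K \<inter> {p. fst p = c})"
        by (meson open_contains_ball)
      obtain e where e: "e > 0" "\<And>q. q \<in> C \<Longrightarrow> dist q (c, y) < e \<Longrightarrow> fst q = c"
        using H(2)[OF c] y by auto
      have "(c, y) \<in> closure K" using c C by (simp add: frontier_def)
      then obtain q where q: "q \<in> K" "dist q (c, y) < min d e"
        using d e by (metis closure_approachable min_less_iff_conj)
      then have "fst q = c" using e(2)[of q] KC by auto
      then show False using d q by (auto simp: dist_commute)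
    qed
    \<comment> \<open>A height outside \<open>H\<close> is available: the vertical section of the
      inside through \<open>a\<close> is open and nonempty, hence not contained in a finite
      set.\<close>
    obtain a y0 where "(a, y0) \<in> inside C" using J(2) by auto
    then have "{y. (a, y) \<in> inside C} \<noteq> {}" by auto
    moreover have "open {y. (a, y) \<in> inside C}"
      using open_vimage[OF J(3), of "\<lambda>y. (a, y)"] by (simp add: vimage_def continuous_intros)
    ultimately have "\<not> {y. (a, y) \<in> inside C} \<subseteq> H"
      using finite_imp_not_open H(1) finite_subset by metis
    then obtain y where y: "(a, y) \<in> inside C" "y \<notin> H" by blast
    obtain N where N: "\<And>p. p \<in> inside C \<Longrightarrow> norm p \<le> N" using J(7) by (meson bounded_iff)
    \<comment> \<open>Following the row from \<open>(a, y)\<close> beyond the bound \<open>N\<close>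
      leaves the inside and so meets the curve. This is done to the left and to the right.\<close>
    have hit: "\<exists>c\<in>S. (c, y) \<in> C" if S: "connected S" "a \<in> S" "\<bar>b\<bar> > N" "b \<in> S" for S b
    proof -
      have "connected ((\<lambda>x. (x, y)) ` S)"
        using S by (intro connected_continuous_image continuous_intros)
      moreover have "(b, y) \<notin> inside C" using N[of "(b, y)"] S(3) norm_fst_le[of b y] by auto
      ultimately have "(\<lambda>x. (x, y)) ` S \<inter> frontier (inside C) \<noteq> {}"
        using S y by (intro connected_Int_frontier) auto
      then show ?thesis using J(9) by auto
    qed
    have "\<exists>c\<in>{..a}. (c, y) \<in> C"
    proof (rule hit)
      show "N < \<bar>- \<bar>a\<bar> - \<bar>N\<bar> - 1\<bar>" by linarith
      show "- \<bar>a\<bar> - \<bar>N\<bar> - 1 \<in> {..a}" by simp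
    qed (auto simp: connected_iff_interval)
    then obtain c1 where c1: "c1 \<le> a" "(c1, y) \<in> C" by auto
    have "\<exists>c\<in>{a..}. (c, y) \<in> C"
    proof (rule hit)
      show "N < \<bar>\<bar>a\<bar> + \<bar>N\<bar> + 1\<bar>" by linarith
      show "\<bar>a\<bar> + \<bar>N\<bar> + 1 \<in> {a..}" by simp
    qed (auto simp: connected_iff_interval)
    then obtain c2 where c2: "a \<le> c2" "(c2, y) \<in> C" by auto
    have "(a, y) \<in> K"
      using line_convex_row[OF Kc inK[OF c1(2)] inK[OF c2(2)]] y c1 c2 by simp
    then show ?thesis using \<open>inside C \<inter> K = {}\<close> y by blast
  qed
qed

section \<open>Counting grid points on the frontier of a line-convex domain\<close>

definition orthodomain :: "point set \<Rightarrow> bool" where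
  "orthodomain U \<longleftrightarrow> open U \<and> connected U \<and> line_convex U"

lemma linear_swap: "linear (prod.swap :: point \<Rightarrow> point)"
  by (auto simp: linear_iff)

lemma bij_swap: "bij (prod.swap :: point \<Rightarrow> point)"
  by simp

lemma closure_swap: "closure (prod.swap ` U) = prod.swap ` closure (U :: point set)"
  using closure_injective_linear_image[OF linear_swap] by simp

lemma frontier_swap: "frontier (prod.swap ` U) = prod.swap ` frontier (U :: point set)"
  unfolding frontier_def closure_swap interior_bijective_linear_image[OF linear_swap bij_swap]
  by (simp add: image_set_diff)

lemma orthodomain_swap:
  assumes "orthodomain U"
  shows "orthodomain (prod.swap ` U)"
proof -
  have "open (prod.swap ` U)"
    using assms linear_swap by (intro open_surjective_linear_image) (auto simp: orthodomain_def)
  moreover have "connected (prod.swap ` U)"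
    using assms linear_swap by (auto simp: orthodomain_def intro: connected_linear_image)
  ultimately show ?thesis
    using assms by (auto simp: orthodomain_def line_convex_def)
qed

section \<open>The closure of a connected line-convex domain\<close>

text \<open>The signs cover the four reflected versions at once. For both signs 1, \<open>U\<close>
  connects a point left of the column \<open>x\<close> and below height \<open>k\<close> to a point
  of that column above \<open>k\<close>. It must cross height \<open>k\<close> on the left or cross
  the column below \<open>k\<close>; in the second case column-convexity puts \<open>(x, k)\<close>
  into \<open>U\<close>.\<close>

lemma orthodomain_half_plane:
  fixes \<sigma> \<tau> :: real
  assumes U: "orthodomain U" and \<sigma>: "\<sigma> = 1 \<or> \<sigma> = -1" and \<tau>: "\<tau> = 1 \<or> \<tau> = -1"
    and a: "(a, h) \<in> U" "\<sigma> * (a - x) \<le> 0" and j: "(x, j) \<in> U"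
    and k: "\<tau> * (h - k) < 0" "\<tau> * (j - k) > 0"
  shows "\<exists>a'. \<sigma> * (a' - x) \<le> 0 \<and> (a', k) \<in> U"
proof (rule ccontr)
  assume no: "\<not> ?thesis"
  have lc: "line_convex U" using U by (simp add: orthodomain_def)
  have col: False if "(x, z) \<in> U" "\<tau> * (z - k) < 0" for z
  proof -
    have "(x, k) \<in> U"
      using \<tau> line_convex_column[OF lc that(1) j, of k] line_convex_column[OF lc j that(1), of k] k that
      by auto
    then show False using no by auto
  qed
  \<comment> \<open>If the half plane avoids height \<open>k\<close>, the quadrant \<open>A\<close> is separated from the rest of \<open>U\<close>.\<close>
  define A where "A = {q. \<sigma> * (fst q - x) < 0} \<inter> {q. \<tau> * (snd q - k) < 0}"
  define B where "B = {q. \<sigma> * (fst q - x) > 0} \<union> {q. \<tau> * (snd q - k) > 0}"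
  have "open A" "open B"
    unfolding A_def B_def
    by (intro open_Int open_Un open_Collect_less continuous_intros)+
  moreover have "connected U" using U by (simp add: orthodomain_def)
  moreover have "A \<inter> B \<inter> U = {}" by (auto simp: A_def B_def)
  moreover have "U \<subseteq> A \<union> B"
  proof
    fix q assume q: "q \<in> U"
    consider "\<sigma> * (fst q - x) > 0" | "\<sigma> * (fst q - x) < 0" | "fst q = x" using \<sigma> by fastforce
    then show "q \<in> A \<union> B"
    proof cases
      case 2
      then have "snd q \<noteq> k" using no q by (metis less_imp_le prod.collapse)
      then show ?thesis using 2 \<tau> by (auto simp: A_def B_def)
    next
      case 3
      then have "(x, snd q) \<in> U" using q by auto
      then show ?thesis using col[of "snd q"] no \<tau> by (cases "snd q = k") (auto simp: B_def)
    qed (auto simp: B_def)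
  qed
  moreover have "(a, h) \<in> A \<inter> U"
    using a k col[of h] \<sigma> by (cases "a = x") (auto simp: A_def)
  moreover have "(x, j) \<in> B \<inter> U" using j k by (auto simp: B_def)
  ultimately show False using connectedD[of U A B] by blast
qed

lemma closure_approach_point:
  fixes U :: "point set"
  assumes "(x, y) \<in> closure U" "\<delta> > 0"
  obtains a h where "(a, h) \<in> U" "\<bar>a - x\<bar> < \<delta>" "\<bar>h - y\<bar> < \<delta>"
proof -
  obtain q where q: "q \<in> U" "dist q (x, y) < \<delta>"
    using assms closure_approachable by metis
  show ?thesis
    using that[of "fst q" "snd q"] q dist_fst_le[of q "(x, y)"] dist_snd_le[of q "(x, y)"]
    by (auto simp: dist_real_def)
qed

text \<open>Otherwise \<open>U\<close> has no point of the column \<open>x\<close> in a band around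
  height \<open>y\<close>, but has points of the band on both sides of the column. By connectedness
  \<open>U\<close> meets the column, above or below the band. The half-plane lemma then moves the
  point farther from this meeting point to the height of the nearer one, and row-convexity yields a
  point of the column inside the band.\<close>

lemma orthodomain_closure_column:
  assumes U: "orthodomain U" and c: "(x1, y) \<in> closure U" "(x2, y) \<in> closure U" "x1 < x" "x < x2"
  shows "y \<in> closure {z. (x, z) \<in> U}"
proof (rule ccontr)
  assume "\<not> ?thesis"
  then obtain \<delta> where \<delta>: "\<delta> > 0" "\<And>z. (x, z) \<in> U \<Longrightarrow> \<bar>z - y\<bar> \<ge> \<delta>"
    unfolding closure_approachable dist_real_def by force
  have lc: "line_convex U" using U by (simp add: orthodomain_def)
  obtain a h where a: "(a, h) \<in> U" "a < x" "\<bar>h - y\<bar> < \<delta>"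
    by (rule closure_approach_point[OF c(1), of "min \<delta> (x - x1)"]) (use \<delta> c in auto)
  obtain b k where b: "(b, k) \<in> U" "x < b" "\<bar>k - y\<bar> < \<delta>"
    by (rule closure_approach_point[OF c(2), of "min \<delta> (x2 - x)"]) (use \<delta> c in auto)
  have "\<exists>j. (x, j) \<in> U"
  proof (rule ccontr)
    assume "\<not> ?thesis"
    then have "fst q \<noteq> x" if "q \<in> U" for q using that by (metis prod.collapse)
    then have "U \<subseteq> {q. fst q < x} \<union> {q. x < fst q}" by fastforce
    moreover have "open {q::point. fst q < x}" "open {q::point. x < fst q}"
      by (intro open_Collect_less continuous_intros)+
    moreover have "connected U" using U by (simp add: orthodomain_def)
    ultimately have "{q. fst q < x} \<inter> U = {} \<or> {q. x < fst q} \<inter> U = {}"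
      by (intro connectedD) auto
    moreover have "(a, h) \<in> {q. fst q < x} \<inter> U" "(b, k) \<in> {q. x < fst q} \<inter> U"
      using a b by auto
    ultimately show False by blast
  qed
  then obtain j where j: "(x, j) \<in> U" by blast
  \<comment> \<open>The sign records whether \<open>j\<close> is above or below the band;
    \<open>h\<close> and \<open>k\<close> lie inside it, so both are on the other side of
    \<open>j\<close>.\<close>
  define \<tau> :: real where "\<tau> = (if j > y then 1 else -1)"
  have \<tau>: "\<tau> = 1 \<or> \<tau> = -1" "\<tau> * (j - h) > 0" "\<tau> * (j - k) > 0"
    using \<delta>(2)[OF j] a b by (auto simp: \<tau>_def)
  have no: "(x, z) \<notin> U" if "\<bar>z - y\<bar> < \<delta>" for z using \<delta>(2)[of z] that by auto
  consider "h = k" | "\<tau> * (h - k) < 0" | "\<tau> * (k - h) < 0" using \<tau> by fastforce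
  then show False
  proof cases
    case 1
    then show False using line_convex_row[OF lc a(1), of b x] a b no by auto
  next
    case 2
    obtain a' where "a' \<le> x" "(a', k) \<in> U"
      using orthodomain_half_plane[OF U, of 1 \<tau> a h x j k] a j \<tau> 2 by auto
    then show False using line_convex_row[OF lc _ b(1), of a' x] b no by auto
  next
    case 3
    obtain b' where "x \<le> b'" "(b', h) \<in> U"
      using orthodomain_half_plane[OF U, of "-1" \<tau> b k x j h] b j \<tau> 3 by auto
    then show False using line_convex_row[OF lc a(1), of b' x] a no by auto
  qed
qed

lemma orthodomain_closure_row:
  assumes U: "orthodomain U" and c: "(x1, y) \<in> closure U" "(x2, y) \<in> closure U" "x1 \<le> x" "x \<le> x2"
  shows "(x, y) \<in> closure U"
proof (cases "x = x1 \<or> x = x2")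
  case False
  then have "y \<in> closure {z. (x, z) \<in> U}"
    using orthodomain_closure_column[OF U c(1,2)] c by auto
  then have "(x, y) \<in> Pair x ` closure {z. (x, z) \<in> U}" by simp
  also have "\<dots> \<subseteq> closure (Pair x ` {z. (x, z) \<in> U})"
    by (intro image_closure_subset continuous_intros) (auto intro: closure_subset[THEN subsetD])
  also have "\<dots> \<subseteq> closure U" by (intro closure_mono) auto
  finally show ?thesis .
qed (use c in auto)

section \<open>Frontier points in rows and columns\<close>

lemma card_le_2_if_no_between:
  fixes E :: "'a::linorder set"
  assumes "\<And>a x b. a \<in> E \<Longrightarrow> x \<in> E \<Longrightarrow> b \<in> E \<Longrightarrow> a < x \<Longrightarrow> x < b \<Longrightarrow> False"
  shows "finite E \<and> card E \<le> 2"
proof (rule ccontr)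
  assume "\<not> ?thesis"
  then have "\<exists>F. finite F \<and> card F = 3 \<and> F \<subseteq> E"
    by (metis infinite_arbitrarily_large not_less_eq_eq numeral_2_eq_2 numeral_3_eq_3 obtain_subset_with_card_n)
  then obtain a b c where "a \<in> E" "b \<in> E" "c \<in> E" "a \<noteq> b" "b \<noteq> c" "a \<noteq> c"
    by (auto simp: card_3_iff)
  then show False
    using assms by (metis linorder_neqE)
qed

lemma card_UN_pairs_le:
  assumes "finite I" "\<And>i. i \<in> I \<Longrightarrow> finite (A i) \<and> card (A i) \<le> 2"
  shows "card (\<Union>i\<in>I. A i) \<le> 2 * card I"
proof -
  have "card (\<Union>i\<in>I. A i) \<le> (\<Sum>i\<in>I. card (A i))" using assms(1) by (rule card_UN_le)
  also have "\<dots> \<le> card I * 2" using assms sum_bounded_above[of I "\<lambda>i. card (A i)" 2] by auto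
  finally show ?thesis by simp
qed

lemma frontier_open_eq: "open U \<Longrightarrow> frontier U = closure U - U"
  by (simp add: frontier_def interior_open)

text \<open>A frontier point either is an extreme point of its row of the closure, or lies strictly
  between two closure points and is then an end of its column of \<open>U\<close> by
  \<open>orthodomain_closure_column\<close>. Each row and each column contributes at most two such
  points. Rows are counted for the closure, columns only for \<open>U\<close> itself.\<close>

lemma card_frontier_grid_le:
  assumes U: "orthodomain U" and G: "finite G"
  shows "card (frontier U \<inter> G \<times> G) \<le>
    2 * card {y \<in> G. \<exists>x. (x, y) \<in> closure U} + 2 * card {x \<in> G. \<exists>y. (x, y) \<in> U}"
proof -
  have lc: "line_convex U" and op: "open U" using U by (auto simp: orthodomain_def)
  define E where "E = (\<lambda>y. {x. (x, y) \<in> closure U \<and>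
    \<not> (\<exists>a b. a < x \<and> x < b \<and> (a, y) \<in> closure U \<and> (b, y) \<in> closure U)})"
  define F where "F = (\<lambda>x. closure {y. (x, y) \<in> U} - {y. (x, y) \<in> U})"
  let ?R = "{y \<in> G. \<exists>x. (x, y) \<in> closure U}" and ?Q = "{x \<in> G. \<exists>y. (x, y) \<in> U}"
  have E: "finite (E y) \<and> card (E y) \<le> 2" for y
    unfolding E_def by (rule card_le_2_if_no_between) blast
  have F: "finite (F x) \<and> card (F x) \<le> 2" for x
  proof (rule card_le_2_if_no_between)
    fix a y b assume F: "a \<in> F x" "y \<in> F x" "b \<in> F x" and lt: "a < y" "y < b"
    have ab: "a \<in> closure {y. (x, y) \<in> U}" "b \<in> closure {y. (x, y) \<in> U}"
      using F by (auto simp: F_def)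
    obtain a' where a': "(x, a') \<in> U" "\<bar>a' - a\<bar> < y - a"
      using ab(1) lt unfolding closure_approachable dist_real_def by (metis diff_gt_0_iff_gt mem_Collect_eq)
    obtain b' where b': "(x, b') \<in> U" "\<bar>b' - b\<bar> < b - y"
      using ab(2) lt unfolding closure_approachable dist_real_def by (metis diff_gt_0_iff_gt mem_Collect_eq)
    have "(x, y) \<in> U" using line_convex_column[OF lc a'(1) b'(1), of y] a'(2) b'(2) by linarith
    then show False using F by (auto simp: F_def)
  qed
  have sub: "frontier U \<inter> G \<times> G \<subseteq> (\<Union>y\<in>?R. (\<lambda>x. (x, y)) ` E y) \<union> (\<Union>x\<in>?Q. Pair x ` F x)"
  proof
    fix q assume "q \<in> frontier U \<inter> G \<times> G"
    then obtain x y where q: "q = (x, y)" "x \<in> G" "y \<in> G" "(x, y) \<in> closure U" "(x, y) \<notin> U"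
      using frontier_open_eq[OF op] by auto
    show "q \<in> (\<Union>y\<in>?R. (\<lambda>x. (x, y)) ` E y) \<union> (\<Union>x\<in>?Q. Pair x ` F x)"
    proof (cases "x \<in> E y")
      case False
      then have "y \<in> closure {z. (x, z) \<in> U}"
        using q orthodomain_closure_column[OF U] by (auto simp: E_def)
      moreover from this have "\<exists>z. (x, z) \<in> U" by (metis Collect_empty_eq closure_empty empty_iff)
      ultimately have "y \<in> F x" "\<exists>z. (x, z) \<in> U" using q by (auto simp: F_def)
      then show ?thesis using q by blast
    qed (use q in blast)
  qed
  have "card (\<Union>y\<in>?R. (\<lambda>x. (x, y)) ` E y) \<le> 2 * card ?R"
    using G E by (intro card_UN_pairs_le) (auto intro: order_trans[OF card_image_le])
  moreover have "card (\<Union>x\<in>?Q. Pair x ` F x) \<le> 2 * card ?Q"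
    using G F by (intro card_UN_pairs_le) (auto intro: order_trans[OF card_image_le])
  moreover have "card (frontier U \<inter> G \<times> G) \<le>
    card ((\<Union>y\<in>?R. (\<lambda>x. (x, y)) ` E y) \<union> (\<Union>x\<in>?Q. Pair x ` F x))"
    using G E F by (intro card_mono[OF _ sub]) auto
  ultimately show ?thesis
    using card_Un_le[of "\<Union>y\<in>?R. (\<lambda>x. (x, y)) ` E y" "\<Union>x\<in>?Q. Pair x ` F x"] by linarith
qed

definition has_horizontal_segment :: "point set \<Rightarrow> real \<Rightarrow> bool" where
  "has_horizontal_segment C y \<longleftrightarrow> (\<exists>a b. a < b \<and> (\<forall>x. a \<le> x \<and> x \<le> b \<longrightarrow> (x, y) \<in> C))"

text \<open>If \<open>x\<close> is a frontier point between two others, row-convexity keeps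
  \<open>U\<close> off the row on one side of \<open>x\<close>. On that side the row-convex closure
  supplies a horizontal piece of frontier.\<close>

lemma card_frontier_row_le_2:
  assumes U: "orthodomain U" and "\<not> has_horizontal_segment (frontier U) y"
  shows "finite {x. (x, y) \<in> frontier U} \<and> card {x. (x, y) \<in> frontier U} \<le> 2"
proof (rule card_le_2_if_no_between)
  have lc: "line_convex U" and op: "open U" using U by (auto simp: orthodomain_def)
  note fr = frontier_open_eq[OF op]
  fix a x b assume "a \<in> {x. (x, y) \<in> frontier U}" "x \<in> {x. (x, y) \<in> frontier U}"
    "b \<in> {x. (x, y) \<in> frontier U}" and lt: "a < x" "x < b"
  then have c: "(a, y) \<in> closure U" "(x, y) \<in> closure U" "(b, y) \<in> closure U" "(x, y) \<notin> U"
    by (auto simp: fr)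
  have "(\<forall>z\<le>x. (z, y) \<notin> U) \<or> (\<forall>z\<ge>x. (z, y) \<notin> U)"
    using line_convex_row[OF lc] c(4) by blast
  then have "(\<forall>z. a \<le> z \<and> z \<le> x \<longrightarrow> (z, y) \<in> frontier U) \<or> (\<forall>z. x \<le> z \<and> z \<le> b \<longrightarrow> (z, y) \<in> frontier U)"
    using orthodomain_closure_row[OF U c(1,2)] orthodomain_closure_row[OF U c(2,3)] by (auto simp: fr)
  then show False using assms(2) lt by (auto simp: has_horizontal_segment_def)
qed

section \<open>Inner corners\<close>

lemma quadrant_signs:
  assumes "0 \<le> \<theta>" "\<theta> < 2 * pi"
  shows "0 \<le> sin \<theta> \<longleftrightarrow> \<theta> \<le> pi" "sin \<theta> \<le> 0 \<longleftrightarrow> \<theta> = 0 \<or> pi \<le> \<theta>"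
    "0 \<le> cos \<theta> \<longleftrightarrow> \<theta> \<le> pi / 2 \<or> 3 * pi / 2 \<le> \<theta>" "cos \<theta> \<le> 0 \<longleftrightarrow> pi / 2 \<le> \<theta> \<and> \<theta> \<le> 3 * pi / 2"
proof -
  have s: "0 < \<theta> \<Longrightarrow> \<theta> < pi \<Longrightarrow> 0 < sin \<theta>" "pi < \<theta> \<Longrightarrow> sin \<theta> < 0"
    using sin_gt_zero sin_lt_zero assms by auto
  show "0 \<le> sin \<theta> \<longleftrightarrow> \<theta> \<le> pi" "sin \<theta> \<le> 0 \<longleftrightarrow> \<theta> = 0 \<or> pi \<le> \<theta>"
    using s assms sin_zero sin_pi by (smt (verit))+
  have c: "\<theta> < pi / 2 \<Longrightarrow> 0 < cos \<theta>" "3 * pi / 2 < \<theta> \<Longrightarrow> 0 < cos \<theta>"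
    "pi / 2 < \<theta> \<Longrightarrow> \<theta> < 3 * pi / 2 \<Longrightarrow> cos \<theta> < 0"
    using cos_gt_zero_pi[of \<theta>] cos_gt_zero_pi[of "\<theta> - 2 * pi"] cos_gt_zero_pi[of "\<theta> - pi"] assms
    by (auto simp: cos_diff)
  have z: "cos (pi / 2) = 0" "cos (3 * pi / 2) = 0"
    using cos_periodic_pi[of "pi / 2"] by (auto simp: field_simps)
  consider "\<theta> < pi / 2" | "\<theta> = pi / 2" | "pi / 2 < \<theta>" "\<theta> < 3 * pi / 2" | "\<theta> = 3 * pi / 2" | "3 * pi / 2 < \<theta>"
    by linarith
  then have "(0 \<le> cos \<theta> \<longleftrightarrow> \<theta> \<le> pi / 2 \<or> 3 * pi / 2 \<le> \<theta>) \<and> (cos \<theta> \<le> 0 \<longleftrightarrow> pi / 2 \<le> \<theta> \<and> \<theta> \<le> 3 * pi / 2)"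
    by cases (smt (verit) c z pi_gt_zero)+
  then show "0 \<le> cos \<theta> \<longleftrightarrow> \<theta> \<le> pi / 2 \<or> 3 * pi / 2 \<le> \<theta>" "cos \<theta> \<le> 0 \<longleftrightarrow> pi / 2 \<le> \<theta> \<and> \<theta> \<le> 3 * pi / 2"
    by auto
qed

lemma measure_lebesgue_three_quadrants:
  fixes \<sigma> \<tau> :: real
  assumes \<sigma>: "\<sigma> = 1 \<or> \<sigma> = -1" and \<tau>: "\<tau> = 1 \<or> \<tau> = -1"
  shows "measure lebesgue {\<theta> \<in> {0..<2 * pi}. \<not> (0 \<le> \<sigma> * cos \<theta> \<and> 0 \<le> \<tau> * sin \<theta>)} = 3 * pi / 2"
    (is "measure _ ?S = _")
proof -
  have m: "measure lebesgue ({a..<b} \<union> {c<..<d}) = (b - a) + (d - c)" if "a \<le> b" "b \<le> c" "c \<le> d" for a b c d :: real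
    using that by (subst measure_Union) auto
  have pi: "0 < pi" by (rule pi_gt_zero)
  have S: "?S = {\<theta>. 0 \<le> \<theta> \<and> \<theta> < 2 * pi \<and>
      \<not> ((if \<sigma> = 1 then \<theta> \<le> pi / 2 \<or> 3 * pi / 2 \<le> \<theta> else pi / 2 \<le> \<theta> \<and> \<theta> \<le> 3 * pi / 2) \<and>
         (if \<tau> = 1 then \<theta> \<le> pi else \<theta> = 0 \<or> pi \<le> \<theta>))}"
  proof (rule Collect_cong)
    fix \<theta> :: real
    show "(\<theta> \<in> {0..<2 * pi} \<and> \<not> (0 \<le> \<sigma> * cos \<theta> \<and> 0 \<le> \<tau> * sin \<theta>)) \<longleftrightarrow>
      (0 \<le> \<theta> \<and> \<theta> < 2 * pi \<and>
      \<not> ((if \<sigma> = 1 then \<theta> \<le> pi / 2 \<or> 3 * pi / 2 \<le> \<theta> else pi / 2 \<le> \<theta> \<and> \<theta> \<le> 3 * pi / 2) \<and>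
         (if \<tau> = 1 then \<theta> \<le> pi else \<theta> = 0 \<or> pi \<le> \<theta>)))"
    proof (cases "0 \<le> \<theta> \<and> \<theta> < 2 * pi")
      case True
      then show ?thesis using \<sigma> \<tau> quadrant_signs[of \<theta>] by (elim disjE) simp_all
    qed (simp only: atLeastLessThan_iff, blast)
  qed
  \<comment> \<open>The remaining directions form one interval if the missing closed quadrant
    contains direction 0, that is for \<open>\<sigma> = 1\<close>, and two intervals
    otherwise.\<close>
  consider "\<sigma> = 1" "\<tau> = 1" | "\<sigma> = -1" "\<tau> = 1" | "\<sigma> = -1" "\<tau> = -1" | "\<sigma> = 1" "\<tau> = -1"
    using \<sigma> \<tau> by auto
  then show ?thesis
  proof cases
    case 1
    then have "?S = {pi / 2<..<2 * pi}" unfolding S using pi by auto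
    then show ?thesis by simp
  next
    case 2
    then have S': "?S = {0..<pi / 2} \<union> {pi<..<2 * pi}" unfolding S using pi by auto
    show ?thesis unfolding S' by (subst m) (use pi in auto)
  next
    case 3
    then have S': "?S = {0..<pi} \<union> {3 * pi / 2<..<2 * pi}" unfolding S using pi by auto
    show ?thesis unfolding S' by (subst m) (use pi in auto)
  next
    case 4
    then have "?S = {0<..<3 * pi / 2}" unfolding S using pi by auto
    then show ?thesis using pi by simp
  qed
qed

text \<open>
  The local picture at a corner with interior angle 270 degrees; the signs select the closed
  quadrant that is missing from the domain.
\<close>

definition reflex_point :: "point set \<Rightarrow> point \<Rightarrow> bool" where
  "reflex_point U p \<longleftrightarrow>
     (\<exists>\<sigma>\<in>{1, -1}. \<exists>\<tau>\<in>{1, -1}. \<exists>\<epsilon>>0. \<forall>x y. \<bar>x\<bar> < \<epsilon> \<longrightarrow> \<bar>y\<bar> < \<epsilon> \<longrightarrow>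
        (p + (x, y) \<in> U \<longleftrightarrow> \<not> (0 \<le> \<sigma> * x \<and> 0 \<le> \<tau> * y)))"

lemma reflex_point_swap:
  assumes "reflex_point U p"
  shows "reflex_point (prod.swap ` U) (prod.swap p)"
proof -
  obtain \<sigma> \<tau> \<epsilon> where *: "\<sigma> \<in> {1, -1}" "\<tau> \<in> {1, -1}" "\<epsilon> > 0"
    "\<And>x y. \<bar>x\<bar> < \<epsilon> \<Longrightarrow> \<bar>y\<bar> < \<epsilon> \<Longrightarrow> (p + (x, y) \<in> U) = (\<not> (0 \<le> \<sigma> * x \<and> 0 \<le> \<tau> * y))"
    using assms unfolding reflex_point_def by meson
  have "(prod.swap p + (x, y) \<in> prod.swap ` U) = (p + (y, x) \<in> U)" for x y
    by (cases p) auto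
  then show ?thesis
    unfolding reflex_point_def using * by (intro bexI[of _ \<tau>] bexI[of _ \<sigma>] exI[of _ \<epsilon>]) auto
qed

text \<open>The two sides of the missing quadrant are limits of \<open>U\<close> without belonging
  to it, which gives the two segments of a corner. Membership near \<open>p\<close> depends only on
  the direction from \<open>p\<close>, so the angle is the measure of three quadrants.\<close>

lemma reflex_point_inner_corner:
  assumes fr: "frontier (inside C) = C" and "open (inside C)" and "reflex_point (inside C) p"
  shows "p \<in> inner_corners C"
proof -
  let ?U = "inside C"
  obtain \<sigma> \<tau> \<epsilon> where \<sigma>: "\<sigma> = 1 \<or> \<sigma> = -1" and \<tau>: "\<tau> = 1 \<or> \<tau> = -1" and \<epsilon>: "\<epsilon> > 0"
    and U: "\<And>x y. \<bar>x\<bar> < \<epsilon> \<Longrightarrow> \<bar>y\<bar> < \<epsilon> \<Longrightarrow> (p + (x, y) \<in> ?U) = (\<not> (0 \<le> \<sigma> * x \<and> 0 \<le> \<tau> * y))"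
    using assms(3) unfolding reflex_point_def by (metis empty_iff insert_iff)
  have C: "C = closure ?U - ?U"
    using assms by (metis frontier_def interior_open)
  \<comment> \<open>A point on a side of the quadrant is approximated by stepping a distance
    \<open>s\<close> perpendicularly out of the quadrant.\<close>
  have inC: "p + (x, y) \<in> C" if xy: "\<bar>x\<bar> < \<epsilon>" "\<bar>y\<bar> < \<epsilon>" "0 \<le> \<sigma> * x" "0 \<le> \<tau> * y" "x = 0 \<or> y = 0" for x y
  proof -
    have "p + (x, y) \<in> closure ?U"
      unfolding closure_approachable
    proof (intro allI impI)
      fix e :: real assume e: "e > 0"
      define s where "s = min e \<epsilon> / 2"
      have s: "0 < s" "s < e" "s < \<epsilon>" using e \<epsilon> by (auto simp: s_def)
      show "\<exists>q\<in>?U. dist q (p + (x, y)) < e"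
        using xy(5)
      proof
        assume "x = 0"
        have "p + (- \<sigma> * s, y) \<in> ?U" using U[of "- \<sigma> * s" y] xy s \<sigma> by auto
        then show ?thesis using s \<sigma> \<open>x = 0\<close> by (intro bexI[of _ "p + (- \<sigma> * s, y)"]) (auto simp: dist_Pair_Pair)
      next
        assume "y = 0"
        have "p + (x, - \<tau> * s) \<in> ?U" using U[of x "- \<tau> * s"] xy s \<tau> by auto
        then show ?thesis using s \<tau> \<open>y = 0\<close> by (intro bexI[of _ "p + (x, - \<tau> * s)"]) (auto simp: dist_Pair_Pair)
      qed
    qed
    then show ?thesis using U[of x y] xy C by auto
  qed
  have "corner C p"
    unfolding corner_def
  proof (intro exI conjI)
    show "p + (\<sigma> * (\<epsilon> / 2), 0) \<noteq> p" "p + (0, \<tau> * (\<epsilon> / 2)) \<noteq> p"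
      using \<sigma> \<tau> \<epsilon> by (auto simp: prod_eq_iff)
    have le: "\<bar>u * (s * (\<epsilon> / 2))\<bar> < \<epsilon>" "0 \<le> s * (u * (s * (\<epsilon> / 2)))"
      if "0 \<le> u" "u \<le> 1" "s = 1 \<or> s = -1" for u s :: real
    proof -
      have "u * (\<epsilon> / 2) \<le> 1 * (\<epsilon> / 2)" using that \<epsilon> by (intro mult_right_mono) auto
      then show "\<bar>u * (s * (\<epsilon> / 2))\<bar> < \<epsilon>" "0 \<le> s * (u * (s * (\<epsilon> / 2)))" using that \<epsilon> by auto
    qed
    have seg: "q \<in> closed_segment p (p + v) \<longleftrightarrow> (\<exists>u. 0 \<le> u \<and> u \<le> 1 \<and> q = p + u *\<^sub>R v)" for q v
      by (auto simp: in_segment algebra_simps)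
    show "closed_segment p (p + (\<sigma> * (\<epsilon> / 2), 0)) \<subseteq> C"
    proof
      fix q assume "q \<in> closed_segment p (p + (\<sigma> * (\<epsilon> / 2), 0))"
      then obtain u where "0 \<le> u" "u \<le> 1" "q = p + (u * (\<sigma> * (\<epsilon> / 2)), 0)"
        unfolding seg by (metis mult_zero_right real_scaleR_def scaleR_Pair)
      moreover from this have "\<bar>u * (\<sigma> * (\<epsilon> / 2))\<bar> < \<epsilon>" "0 \<le> \<sigma> * (u * (\<sigma> * (\<epsilon> / 2)))"
        using \<sigma> le[of u \<sigma>] by blast+
      ultimately show "q \<in> C" using inC[of "u * (\<sigma> * (\<epsilon> / 2))" 0] \<epsilon> by (metis abs_zero mult_zero_right order_refl)
    qed
    show "closed_segment p (p + (0, \<tau> * (\<epsilon> / 2))) \<subseteq> C"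
    proof
      fix q assume "q \<in> closed_segment p (p + (0, \<tau> * (\<epsilon> / 2)))"
      then obtain u where "0 \<le> u" "u \<le> 1" "q = p + (0, u * (\<tau> * (\<epsilon> / 2)))"
        unfolding seg by (metis mult_zero_right real_scaleR_def scaleR_Pair)
      moreover from this have "\<bar>u * (\<tau> * (\<epsilon> / 2))\<bar> < \<epsilon>" "0 \<le> \<tau> * (u * (\<tau> * (\<epsilon> / 2)))"
        using \<tau> le[of u \<tau>] by blast+
      ultimately show "q \<in> C" using inC[of 0 "u * (\<tau> * (\<epsilon> / 2))"] \<epsilon> by (metis abs_zero mult_zero_right order_refl)
    qed
  qed auto
  moreover have "interior_angle C p = 3 * pi / 2"
  proof -
    have "(\<forall>\<^sub>F t in at_right 0. p + t *\<^sub>R (cos \<theta>, sin \<theta>) \<in> ?U) \<longleftrightarrow> \<not> (0 \<le> \<sigma> * cos \<theta> \<and> 0 \<le> \<tau> * sin \<theta>)" for \<theta>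
    proof -
      have "\<forall>\<^sub>F t in at_right (0::real). 0 < t \<and> t < \<epsilon>"
        using \<epsilon> by (auto simp: eventually_at_right_field intro!: exI[of _ \<epsilon>])
      then have "\<forall>\<^sub>F t in at_right 0. (p + t *\<^sub>R (cos \<theta>, sin \<theta>) \<in> ?U) = (\<not> (0 \<le> \<sigma> * cos \<theta> \<and> 0 \<le> \<tau> * sin \<theta>))"
      proof eventually_elim
        case (elim t)
        have "\<bar>t * cos \<theta>\<bar> \<le> t * 1" "\<bar>t * sin \<theta>\<bar> \<le> t * 1"
          unfolding abs_mult using elim by (intro mult_mono; simp)+
        then have "(p + (t * cos \<theta>, t * sin \<theta>) \<in> ?U) = (\<not> (0 \<le> \<sigma> * (t * cos \<theta>) \<and> 0 \<le> \<tau> * (t * sin \<theta>)))"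
          using elim by (intro U) auto
        moreover have "0 \<le> \<sigma> * (t * cos \<theta>) \<longleftrightarrow> 0 \<le> \<sigma> * cos \<theta>" "0 \<le> \<tau> * (t * sin \<theta>) \<longleftrightarrow> 0 \<le> \<tau> * sin \<theta>"
          using elim by (simp_all add: zero_le_mult_iff mult_le_0_iff)
        ultimately show ?case by simp
      qed
      from eventually_subst[OF this] show ?thesis by simp
    qed
    then show ?thesis
      unfolding interior_angle_def using measure_lebesgue_three_quadrants[OF \<sigma> \<tau>] by simp
  qed
  ultimately show ?thesis by (simp add: inner_corners_def)
qed

section \<open>The reflex point at the end of a row\<close>

lemma open_interval_right_end:
  fixes I :: "real set"
  assumes I: "open I" "is_interval I" and z: "z \<in> I" and e: "e \<notin> I" "z < e"
  obtains t where "z < t" "t \<le> e" "\<And>x. z \<le> x \<Longrightarrow> x < t \<Longrightarrow> x \<in> I" "\<And>x. t \<le> x \<Longrightarrow> x \<notin> I"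
proof -
  have ub: "x < e" if "x \<in> I" for x
    using mem_is_interval_1_I[OF I(2) z that, of e] e by (cases "e \<le> x") auto
  then have bdd: "bdd_above I" by (metis bdd_aboveI order_less_imp_le)
  have max: "\<exists>y\<in>I. x < y" if x: "x \<in> I" for x
  proof -
    obtain d where "d > 0" "ball x d \<subseteq> I" using I(1) x by (rule openE)
    then show ?thesis by (intro bexI[of _ "x + d / 2"]) (auto simp: dist_real_def)
  qed
  have lt: "x < Sup I" if "x \<in> I" for x
    using max[OF that] cSup_upper[OF _ bdd] by fastforce
  show ?thesis
  proof (rule that[of "Sup I"])
    show "z < Sup I" using lt z by blast
    show "Sup I \<le> e" using z ub by (intro cSup_least) fastforce+
    show "x \<in> I" if x: "z \<le> x" "x < Sup I" for x
    proof -
      obtain y where "y \<in> I" "x < y" using less_cSupD[OF _ x(2)] z by blast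
      then show ?thesis using mem_is_interval_1_I[OF I(2) z] x by simp
    qed
    show "x \<notin> I" if "Sup I \<le> x" for x using lt that by fastforce
  qed
qed

lemma open_interval_end:
  fixes I :: "real set" and \<sigma> :: real
  assumes I: "open I" "is_interval I" and z: "z \<in> I" and e: "e \<notin> I" "0 < \<sigma> * (e - z)"
    and \<sigma>: "\<sigma> = 1 \<or> \<sigma> = -1"
  obtains t where "0 < \<sigma> * (t - z)" "0 \<le> \<sigma> * (e - t)"
    "\<And>x. 0 \<le> \<sigma> * (x - z) \<Longrightarrow> 0 < \<sigma> * (t - x) \<Longrightarrow> x \<in> I" "\<And>x. 0 \<le> \<sigma> * (x - t) \<Longrightarrow> x \<notin> I"
  using \<sigma>
proof
  assume "\<sigma> = 1"
  then show ?thesis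
    using open_interval_right_end[OF I z e(1)] e(2) that by (metis diff_ge_0_iff_ge diff_gt_0_iff_gt mult_1)
next
  assume s: "\<sigma> = -1"
  have "open (uminus ` I)" using I(1) open_negations by blast
  moreover have "is_interval (uminus ` I)" using I(2) is_interval_uminus by blast
  moreover have "- z \<in> uminus ` I" "- e \<notin> uminus ` I" "- z < - e" using z e s by auto
  ultimately obtain t where t: "- z < t" "t \<le> - e"
    "\<And>x. - z \<le> x \<Longrightarrow> x < t \<Longrightarrow> x \<in> uminus ` I" "\<And>x. t \<le> x \<Longrightarrow> x \<notin> uminus ` I"
    using open_interval_right_end by metis
  show ?thesis
  proof (rule that[of "- t"])
    show "0 < \<sigma> * (- t - z)" "0 \<le> \<sigma> * (e - - t)" using s t by auto
    show "x \<in> I" if "0 \<le> \<sigma> * (x - z)" "0 < \<sigma> * (- t - x)" for x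
      using t(3)[of "- x"] that s by auto
    show "x \<notin> I" if "0 \<le> \<sigma> * (x - - t)" for x
      using t(4)[of "- x"] that s by auto
  qed
qed

text \<open>The horizontal segment lies to one side of the row of \<open>U\<close>. The reflex point
  is the end \<open>(t, y)\<close> of the row towards the segment: \<open>low\<close> fills the two
  quadrants on one vertical side of the row, \<open>high\<close> empties the quadrant beyond the end
  of the row on the other side, and \<open>N\<close> is the last quadrant.\<close>

lemma exists_reflex_point:
  assumes U: "orthodomain U" and loc: "locally_cross (frontier U)"
    and z: "(z, y) \<in> U" and seg: "has_horizontal_segment (frontier U) y"
  shows "\<exists>x. reflex_point U (x, y)"
proof -
  have lc: "line_convex U" and op: "open U" using U by (auto simp: orthodomain_def)
  note fr = frontier_open_eq[OF op]
  obtain a b where ab: "a < b" "\<And>x. a \<le> x \<Longrightarrow> x \<le> b \<Longrightarrow> (x, y) \<in> frontier U"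
    using seg unfolding has_horizontal_segment_def by blast
  have nz: "z < a \<or> b < z" using ab(2)[of z] z by (cases "a \<le> z"; cases "z \<le> b") (simp_all add: fr)
  \<comment> \<open>\<open>\<sigma>\<close> is the direction from \<open>z\<close> to the segment,
    \<open>e\<close> its near end and \<open>q\<close> its far end.\<close>
  obtain \<sigma> e q where \<sigma>: "\<sigma> = 1 \<or> \<sigma> = (-1::real)"
    and eq: "0 < \<sigma> * (e - z)" "0 < \<sigma> * (q - e)" "(e, y) \<in> frontier U" "(q, y) \<in> frontier U"
    using nz
  proof
    assume "z < a"
    then show ?thesis using that[of 1 a b] ab by auto
  next
    assume "b < z"
    then show ?thesis using that[of "-1" b a] ab by auto
  qed
  have row: "(x, h) \<in> U" if "(c, h) \<in> U" "(d, h) \<in> U" "0 \<le> \<sigma> * (x - c)" "0 \<le> \<sigma> * (d - x)" for x c d h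
    using \<sigma> line_convex_row[OF lc that(1,2), of x] line_convex_row[OF lc that(2,1), of x] that by auto
  have "open {x. (x, y) \<in> U}"
    using open_vimage[OF op, of "\<lambda>x. (x, y)"] by (simp add: vimage_def continuous_intros)
  then obtain t where t: "0 < \<sigma> * (t - z)" "0 \<le> \<sigma> * (e - t)"
    "\<And>x. 0 \<le> \<sigma> * (x - z) \<Longrightarrow> 0 < \<sigma> * (t - x) \<Longrightarrow> (x, y) \<in> U" "\<And>x. 0 \<le> \<sigma> * (x - t) \<Longrightarrow> (x, y) \<notin> U"
    using lc z eq \<sigma> by (elim open_interval_end[of _ z e \<sigma>]) (auto simp: line_convex_def fr)
  \<comment> \<open>Strictly between the end of the row of \<open>U\<close> and a closure point, so
    that the column \<open>x0\<close> of \<open>U\<close> accumulates at height \<open>y\<close>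
    without containing it.\<close>
  define x0 where "x0 = (t + q) / 2"
  have tq: "0 < \<sigma> * (q - t)" using t(2) eq(2) \<sigma> by auto
  then have x0: "0 < \<sigma> * (x0 - t)" "0 < \<sigma> * (q - x0)" using \<sigma> by (auto simp: x0_def)
  have clz: "(z, y) \<in> closure U" using z closure_subset by blast
  have clq: "(q, y) \<in> closure U" using eq(4) by (simp add: fr)
  have "(t, y) \<in> closure U"
    using \<sigma> orthodomain_closure_row[OF U clz clq, of t] orthodomain_closure_row[OF U clq clz, of t] t(1) tq by auto
  then have p: "(t, y) \<in> frontier U" using t(4)[of t] by (simp add: fr)
  have J: "y \<in> closure {h. (x0, h) \<in> U}"
    using \<sigma> orthodomain_closure_column[OF U clz clq, of x0] orthodomain_closure_column[OF U clq clz, of x0] t(1) x0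
    by auto
  have x0n: "(x0, y) \<notin> U" using t(4) x0(1) by simp
  obtain w where w: "(x0, w) \<in> U" using J by (metis Collect_empty_eq closure_empty empty_iff)
  have wy: "w \<noteq> y" using w x0n by auto
  \<comment> \<open>The column \<open>x0\<close> of \<open>U\<close> misses height \<open>y\<close>,
    so it lies on one vertical side only; \<open>\<tau>\<close> points to the opposite side.\<close>
  define \<tau> :: real where "\<tau> = (if w < y then 1 else -1)"
  have \<tau>: "\<tau> = 1 \<or> \<tau> = -1" "0 < \<tau> * (y - w)" using wy by (auto simp: \<tau>_def)
  have col: "(x, k) \<in> U" if "(x, c) \<in> U" "(x, d) \<in> U" "0 \<le> \<tau> * (k - c)" "0 \<le> \<tau> * (d - k)" for x c d k
    using \<tau>(1) line_convex_column[OF lc that(1,2), of k] line_convex_column[OF lc that(2,1), of k] that by auto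
  have x0low: "(x0, h) \<in> U" if h: "0 < \<tau> * (y - h)" "0 \<le> \<tau> * (h - w)" for h
  proof -
    obtain k where k: "(x0, k) \<in> U" "\<bar>k - y\<bar> < \<bar>y - h\<bar>"
      using J h unfolding closure_approachable dist_real_def
      by (metis abs_of_nonpos linorder_not_le mem_Collect_eq mult_zero_right zero_less_abs_iff order_less_irrefl)
    have "0 < \<tau> * (y - k)"
    proof (rule ccontr)
      assume "\<not> ?thesis"
      then show False using col[OF w k(1), of y] \<tau> x0n by (auto simp: algebra_simps)
    qed
    then show ?thesis using col[OF w k(1), of h] h k(2) \<tau>(1) by auto
  qed
  obtain \<delta>0 where \<delta>0: "\<delta>0 > 0" "\<And>h. \<bar>h - y\<bar> < \<delta>0 \<Longrightarrow> (z, h) \<in> U"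
  proof -
    obtain d where "d > 0" "ball (z, y) d \<subseteq> U" using op z by (rule openE)
    then show ?thesis using that[of d] by (auto simp: dist_Pair_Pair dist_real_def subset_iff abs_minus_commute)
  qed
  \<comment> \<open>Within this distance of \<open>y\<close>, on the side of \<open>w\<close>, both
    columns \<open>z\<close> and \<open>x0\<close> belong to \<open>U\<close>, and row-convexity
    fills the strip between them.\<close>
  define \<delta> where "\<delta> = min \<delta>0 (\<tau> * (y - w))"
  have \<delta>: "\<delta> > 0" using \<delta>0 \<tau> by (simp add: \<delta>_def)
  have low: "(x, h) \<in> U" if "0 \<le> \<sigma> * (x - z)" "0 \<le> \<sigma> * (x0 - x)" "0 < \<tau> * (y - h)" "\<tau> * (y - h) < \<delta>" for x h
  proof -
    have "(z, h) \<in> U" using that \<tau>(1) by (intro \<delta>0) (auto simp: \<delta>_def)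
    moreover have "(x0, h) \<in> U" using that \<tau>(1) by (intro x0low) (auto simp: \<delta>_def)
    ultimately show ?thesis using row that by blast
  qed
  \<comment> \<open>Together with a point of the strip, such a point would put \<open>(x, y)\<close>
    into \<open>U\<close> beyond the end of its row.\<close>
  have high: "(x, h) \<notin> U" if x: "0 \<le> \<sigma> * (x - t)" "0 \<le> \<sigma> * (x0 - x)" and h: "0 \<le> \<tau> * (h - y)" for x h
  proof
    assume xh: "(x, h) \<in> U"
    define k where "k = y - \<tau> * (\<delta> / 2)"
    have k: "\<tau> * (y - k) = \<delta> / 2" using \<tau>(1) by (auto simp: k_def)
    have "0 \<le> \<sigma> * (x - z)" using x(1) t(1) \<sigma> by auto
    then have "(x, k) \<in> U" using low[of x k] x k \<delta> by auto
    moreover have "0 \<le> \<tau> * (y - k)" using k \<delta> by simp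
    ultimately have "(x, y) \<in> U" using col[OF _ xh, of k y] h by simp
    then show False using t(4) x by blast
  qed
  obtain \<epsilon>0 where \<epsilon>0: "\<epsilon>0 > 0"
    "\<And>q. q \<in> frontier U \<Longrightarrow> dist q (t, y) < \<epsilon>0 \<Longrightarrow> fst q = t \<or> snd q = y"
    using loc p unfolding locally_cross_def by (metis fst_conv snd_conv)
  \<comment> \<open>Half of \<open>\<epsilon>0\<close> because the distance is bounded by the sum of
    two coordinates; the other bounds keep the square between the columns \<open>z\<close> and
    \<open>x0\<close> and within the strip.\<close>
  define \<epsilon> where "\<epsilon> = Min {\<epsilon>0 / 2, \<delta>, \<sigma> * (t - z), \<sigma> * (x0 - t)}"
  have \<epsilon>: "\<epsilon> > 0" "\<epsilon> \<le> \<epsilon>0 / 2" "\<epsilon> \<le> \<delta>" "\<epsilon> \<le> \<sigma> * (t - z)" "\<epsilon> \<le> \<sigma> * (x0 - t)"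
    using \<epsilon>0 \<delta> t(1) x0(1) by (auto simp: \<epsilon>_def)
  \<comment> \<open>Line-convexity alone does not put the quadrant \<open>N\<close> next to the row of \<open>U\<close> into \<open>U\<close>;
    the rectilinear shape of the frontier does.\<close>
  define N where "N = (\<lambda>v. (t, y) + v) ` {v. - \<epsilon> < \<sigma> * fst v \<and> \<sigma> * fst v < 0 \<and> 0 < \<tau> * snd v \<and> \<tau> * snd v < \<epsilon>}"
  have "N \<subseteq> U"
  proof -
    have "convex {v. - \<epsilon> < \<sigma> * fst v \<and> \<sigma> * fst v < 0 \<and> 0 < \<tau> * snd v \<and> \<tau> * snd v < \<epsilon>}"
    proof -
      have "convex ((if \<sigma> = 1 then {-\<epsilon><..<0} else {0<..<\<epsilon>}) \<times> (if \<tau> = 1 then {0<..<\<epsilon>} else {-\<epsilon><..<0}))"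
        by (intro convex_Times) auto
      also have "(if \<sigma> = 1 then {-\<epsilon><..<0} else {0<..<\<epsilon>}) \<times> (if \<tau> = 1 then {0<..<\<epsilon>} else {-\<epsilon><..<0})
        = {v. - \<epsilon> < \<sigma> * fst v \<and> \<sigma> * fst v < 0 \<and> 0 < \<tau> * snd v \<and> \<tau> * snd v < \<epsilon>}"
        using \<sigma> \<tau>(1) by auto
      finally show ?thesis .
    qed
    then have "connected N" unfolding N_def by (intro convex_connected convex_translation)
    moreover have "N \<inter> frontier U = {}"
    proof (rule ccontr)
      assume "N \<inter> frontier U \<noteq> {}"
      then obtain v where v: "- \<epsilon> < \<sigma> * fst v" "\<sigma> * fst v < 0" "0 < \<tau> * snd v" "\<tau> * snd v < \<epsilon>"
        "(t, y) + v \<in> frontier U" unfolding N_def by blast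
      have "dist ((t, y) + v) (t, y) = norm v" by (simp add: dist_norm)
      also have "\<dots> \<le> \<bar>fst v\<bar> + \<bar>snd v\<bar>" using norm_Pair_le[of "fst v" "snd v"] by simp
      also have "\<dots> < \<epsilon>0" using v \<sigma> \<tau>(1) \<epsilon>(2) by auto
      finally show False using \<epsilon>0(2)[OF v(5)] v by auto
    qed
    \<comment> \<open>A point of the row just before its end has a ball in \<open>U\<close>, which
      reaches into \<open>N\<close>.\<close>
    moreover have "N \<inter> U \<noteq> {}"
    proof -
      have "(t - \<sigma> * (\<epsilon> / 2), y) \<in> U" using \<sigma> \<epsilon> by (intro t(3)) auto
      with op obtain d where d: "d > 0" "ball (t - \<sigma> * (\<epsilon> / 2), y) d \<subseteq> U" by (rule openE)
      define s where "s = min d \<epsilon> / 2"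
      have s: "0 < s" "s < d" "s < \<epsilon>" using d \<epsilon> by (auto simp: s_def)
      have "(t - \<sigma> * (\<epsilon> / 2), y + \<tau> * s) \<in> U"
        using s \<tau>(1) by (intro subsetD[OF d(2)]) (auto simp: dist_Pair_Pair dist_real_def)
      moreover have "(t - \<sigma> * (\<epsilon> / 2), y + \<tau> * s) \<in> N"
        unfolding N_def using s \<sigma> \<tau>(1) \<epsilon> by (intro image_eqI[of _ _ "(- \<sigma> * (\<epsilon> / 2), \<tau> * s)"]) auto
      ultimately show ?thesis by blast
    qed
    ultimately show ?thesis using connected_Int_frontier[of N U] by blast
  qed
  then have N: "(t + u, y + v) \<in> U" if "- \<epsilon> < \<sigma> * u" "\<sigma> * u < 0" "0 < \<tau> * v" "\<tau> * v < \<epsilon>" for u v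
    using that unfolding N_def by (force simp: image_iff)
  have "(t, y) + (u, v) \<in> U \<longleftrightarrow> \<not> (0 \<le> \<sigma> * u \<and> 0 \<le> \<tau> * v)" if uv: "\<bar>u\<bar> < \<epsilon>" "\<bar>v\<bar> < \<epsilon>" for u v
  proof -
    have su: "\<bar>\<sigma> * u\<bar> < \<epsilon>" "\<bar>\<tau> * v\<bar> < \<epsilon>" using uv \<sigma> \<tau>(1) by auto
    have lin: "\<sigma> * (t + u - t) = \<sigma> * u" "\<sigma> * (t + u - z) = \<sigma> * (t - z) + \<sigma> * u"
      "\<sigma> * (x0 - (t + u)) = \<sigma> * (x0 - t) - \<sigma> * u" "\<sigma> * (t - (t + u)) = - (\<sigma> * u)"
      "\<tau> * (y - (y + v)) = - (\<tau> * v)" "\<tau> * (y + v - y) = \<tau> * v"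
      by (auto simp: algebra_simps)
    consider "0 \<le> \<sigma> * u" "0 \<le> \<tau> * v" | "\<tau> * v < 0" | "\<sigma> * u < 0" "\<tau> * v = 0" | "\<sigma> * u < 0" "0 < \<tau> * v"
      by linarith
    then show ?thesis
    proof cases
      case 1
      then show ?thesis using high[of "t + u" "y + v"] su \<epsilon> unfolding lin by auto
    next
      case 2
      then show ?thesis using low[of "t + u" "y + v"] su \<epsilon> unfolding lin by auto
    next
      case 3
      then have "v = 0" using \<tau> by auto
      then show ?thesis using t(3)[of "t + u"] 3 su \<epsilon> unfolding lin by auto
    next
      case 4
      then show ?thesis using N[of u v] su by auto
    qed
  qed
  then have "reflex_point U (t, y)"
    unfolding reflex_point_def using \<sigma> \<tau>(1) \<epsilon>(1) by blast
  then show ?thesis by blast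
qed

section \<open>Counting rows and columns\<close>

lemma bounded_open_interval_eq:
  fixes H :: "real set"
  assumes H: "open H" "is_interval H" "bounded H" "H \<noteq> {}"
  shows "H = {Inf H<..<Sup H}"
proof -
  have bdd: "bdd_above H" "bdd_below H"
    using H(3) by (auto intro: bounded_imp_bdd_above bounded_imp_bdd_below)
  have 1: "Inf H < y \<and> y < Sup H" if y: "y \<in> H" for y
  proof -
    obtain d where d: "d > 0" "ball y d \<subseteq> H" using H(1) y by (rule openE)
    then have "y + d / 2 \<in> H" "y - d / 2 \<in> H" by (auto simp: subset_iff dist_real_def)
    then show ?thesis
      using cSup_upper[OF _ bdd(1), of "y + d / 2"] cInf_lower[OF _ bdd(2), of "y - d / 2"] d(1) by auto
  qed
  have 2: "y \<in> H" if y: "Inf H < y" "y < Sup H" for y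
  proof -
    obtain a where a: "a \<in> H" "a < y" using cInf_lessD[OF H(4) y(1)] by blast
    obtain b where b: "b \<in> H" "y < b" using less_cSupD[OF H(4) y(2)] by blast
    show ?thesis using mem_is_interval_1_I[OF H(2) a(1) b(1), of y] a b by simp
  qed
  show ?thesis
  proof (intro set_eqI iffI)
    show "y \<in> {Inf H<..<Sup H}" if "y \<in> H" for y using 1[OF that] by simp
    show "y \<in> H" if "y \<in> {Inf H<..<Sup H}" for y using 2[of y] that by simp
  qed
qed

text \<open>Both sums count the pairs \<open>t \<le> y\<close>, so they agree. They add up to
  \<open>card T * (card T + 1)\<close>, as \<open>t\<close> itself is counted from both
  sides.\<close>

lemma sum_card_upper_set:
  fixes T :: "'a::linorder set"
  assumes "finite T"
  shows "2 * (\<Sum>t\<in>T. card {y \<in> T. t \<le> y}) = card T * (card T + 1)"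
    "2 * (\<Sum>t\<in>T. card {y \<in> T. y \<le> t}) = card T * (card T + 1)"
proof -
  have cd: "card {y \<in> T. P y} = (\<Sum>y\<in>T. if P y then 1 else 0)" for P
    using assms by (simp add: sum.If_cases Int_def)
  have sw: "(\<Sum>t\<in>T. card {y \<in> T. t \<le> y}) = (\<Sum>t\<in>T. card {y \<in> T. y \<le> t})"
    unfolding cd by (rule sum.swap)
  have "card {y \<in> T. t \<le> y} + card {y \<in> T. y \<le> t} = card T + 1" if t: "t \<in> T" for t
  proof -
    have "card {y \<in> T. t \<le> y} + card {y \<in> T. y \<le> t} =
      card ({y \<in> T. t \<le> y} \<union> {y \<in> T. y \<le> t}) + card ({y \<in> T. t \<le> y} \<inter> {y \<in> T. y \<le> t})"
      using assms by (intro card_Un_Int) auto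
    moreover have "{y \<in> T. t \<le> y} \<union> {y \<in> T. y \<le> t} = T" "{y \<in> T. t \<le> y} \<inter> {y \<in> T. y \<le> t} = {t}"
      using t by auto
    ultimately show ?thesis by simp
  qed
  then have "(\<Sum>t\<in>T. card {y \<in> T. t \<le> y}) + (\<Sum>t\<in>T. card {y \<in> T. y \<le> t}) = card T * (card T + 1)"
    by (simp add: sum.distrib[symmetric])
  then show "2 * (\<Sum>t\<in>T. card {y \<in> T. t \<le> y}) = card T * (card T + 1)"
    "2 * (\<Sum>t\<in>T. card {y \<in> T. y \<le> t}) = card T * (card T + 1)"
    using sw by auto
qed

section \<open>Regions with at most two reflex points\<close>

text \<open>The properties of the enclosed region that the count uses, all invariant under swapping
  the coordinates, so that a statement about rows also gives one about columns.\<close>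

definition orthocell :: "point set \<Rightarrow> bool" where
  "orthocell U \<longleftrightarrow> orthodomain U \<and> bounded U \<and> U \<noteq> {} \<and> locally_cross (frontier U) \<and>
     finite {p. reflex_point U p} \<and> card {p. reflex_point U p} \<le> 2"

lemma orthoconvex_curve_orthocell:
  assumes C: "orthoconvex_curve C" and "finite (inner_corners C)" "card (inner_corners C) \<le> 2"
  shows "orthocell (inside C)" "frontier (inside C) = C"
proof -
  have "simple_closed_curve C" and rect: "rectilinear C"
    using C by (auto simp: orthoconvex_curve_def)
  note J = Jordan_inside_outside_plane[OF this(1)]
  show fr: "frontier (inside C) = C" by (rule J)
  have sub: "{p. reflex_point (inside C) p} \<subseteq> inner_corners C"
    using reflex_point_inner_corner[OF fr J(3)] by blast
  show "orthocell (inside C)"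
    unfolding orthocell_def orthodomain_def fr
    using J orthoconvex_curve_line_convex_inside[OF C] rectilinear_locally_cross[OF rect]
      finite_subset[OF sub assms(2)] card_mono[OF assms(2) sub] assms(3) by simp
qed

lemma locally_cross_swap:
  assumes "locally_cross C"
  shows "locally_cross (prod.swap ` C)"
proof -
  have d: "dist (prod.swap q) (prod.swap p) = dist q p" for p q :: point
    by (cases p; cases q) (simp add: dist_Pair_Pair add.commute)
  show ?thesis
    using assms unfolding locally_cross_def by (simp add: d) blast
qed

lemma orthocell_swap:
  assumes "orthocell U"
  shows "orthocell (prod.swap ` U)"
proof -
  have "{p. reflex_point (prod.swap ` U) p} \<subseteq> prod.swap ` {p. reflex_point U p}"
  proof clarify
    fix a b assume "reflex_point (prod.swap ` U) (a, b)"
    from reflex_point_swap[OF this] have "reflex_point U (b, a)" by (simp add: image_image)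
    then show "(a, b) \<in> prod.swap ` {p. reflex_point U p}" by force
  qed
  moreover have "finite (prod.swap ` {p. reflex_point U p})" "card (prod.swap ` {p. reflex_point U p}) \<le> 2"
    using assms card_image_le[of "{p. reflex_point U p}" prod.swap] by (auto simp: orthocell_def)
  ultimately have "finite {p. reflex_point (prod.swap ` U) p} \<and> card {p. reflex_point (prod.swap ` U) p} \<le> 2"
    using finite_subset card_mono order_trans by metis
  then show ?thesis
    using assms linear_swap bounded_linear_image[of U prod.swap] orthodomain_swap[of U]
    by (auto simp: orthocell_def frontier_swap linear_conv_bounded_linear intro: locally_cross_swap)
qed

text \<open>The projection of \<open>U\<close> to the vertical axis is a bounded open interval;
  passing to the closure can only add its two end heights.\<close>

lemma orthocell_height:
  assumes "orthocell U"
  shows "(\<exists>x. (x, y) \<in> U) \<longleftrightarrow> Inf (snd ` U) < y \<and> y < Sup (snd ` U)"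
    "(x, y) \<in> closure U \<Longrightarrow> Inf (snd ` U) \<le> y \<and> y \<le> Sup (snd ` U)"
    "Inf (snd ` U) < Sup (snd ` U)"
proof -
  let ?H = "snd ` U"
  have U: "open U" "connected U" "bounded U" "U \<noteq> {}"
    using assms by (auto simp: orthocell_def orthodomain_def)
  have "open ?H" using U(1) by (rule open_map_snd[unfolded open_map_def, simplified] | rule open_image_snd)
  moreover have "is_interval ?H"
    using U(2) by (simp add: is_interval_connected_1 connected_continuous_image continuous_intros)
  moreover have "bounded ?H" using U(3) by (rule bounded_snd)
  ultimately have H: "?H = {Inf ?H<..<Sup ?H}"
    using U(4) by (intro bounded_open_interval_eq) auto
  have row: "(\<exists>x. (x, y) \<in> U) \<longleftrightarrow> y \<in> ?H" for y by force
  then show "(\<exists>x. (x, y) \<in> U) \<longleftrightarrow> Inf ?H < y \<and> y < Sup ?H"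
    using H by (metis greaterThanLessThan_iff)
  show lt: "Inf ?H < Sup ?H" using H U(4) by (metis greaterThanLessThan_empty_iff2 image_is_empty not_le)
  show "Inf ?H \<le> y \<and> y \<le> Sup ?H" if "(x, y) \<in> closure U"
  proof -
    have "y \<in> snd ` closure U" using that by force
    also have "\<dots> \<subseteq> closure ?H" by (intro image_closure_subset continuous_intros closure_subset) auto
    also have "closure ?H = {Inf ?H..Sup ?H}" using H lt closure_greaterThanLessThan by metis
    finally show ?thesis by simp
  qed
qed

section \<open>How many rows the regions meet\<close>

definition rows_met :: "real set \<Rightarrow> point set \<Rightarrow> real set" where
  "rows_met G U = {y \<in> G. \<exists>x. (x, y) \<in> U}"

text \<open>Otherwise each of the \<open>m\<close> frontiers covers at most two of the more than
  \<open>2 * m\<close> grid points in the row.\<close>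

lemma exists_horizontal_segment:
  assumes cells: "\<And>i. i < m \<Longrightarrow> orthocell (U i)"
    and G: "finite G" "2 * m < card G" and cov: "G \<times> G \<subseteq> (\<Union>i<m. frontier (U i))" and y: "y \<in> G"
  shows "\<exists>i<m. has_horizontal_segment (frontier (U i)) y"
proof (rule ccontr)
  assume no: "\<not> ?thesis"
  let ?A = "\<lambda>i. {x. (x, y) \<in> frontier (U i)}"
  have A: "finite (?A i) \<and> card (?A i) \<le> 2" if "i \<in> {..<m}" for i
    using card_frontier_row_le_2 cells[of i] no that by (auto simp: orthocell_def)
  have "G \<subseteq> (\<Union>i\<in>{..<m}. ?A i)" using cov y by blast
  then have "card G \<le> card (\<Union>i\<in>{..<m}. ?A i)" using A by (intro card_mono) auto
  also have "\<dots> \<le> 2 * card {..<m}" using A by (intro card_UN_pairs_le) auto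
  finally show False using G by simp
qed

text \<open>Each row carries a horizontal segment, which is at the top or bottom level of its cell
  or at the height of a reflex point. Reflex points account for at most \<open>2 * m\<close> rows,
  so at least \<open>c\<close> rows are tops or bottoms. A cell misses all rows at or above its top
  and at or below its bottom; distinct tops and distinct bottoms make the total number of missed
  rows quadratic in \<open>c\<close>.\<close>

lemma sum_card_rows_met_le:
  assumes cells: "\<And>i. i < m \<Longrightarrow> orthocell (U i)"
    and G: "finite G" "card G = 2 * m + c" "0 < c" and cov: "G \<times> G \<subseteq> (\<Union>i<m. frontier (U i))"
  shows "4 * (\<Sum>i<m. card (rows_met G (U i))) + c * c + 2 * c \<le> 4 * m * (2 * m + c)"
proof -
  define t where "t = (\<lambda>i. Sup (snd ` U i))"
  define b where "b = (\<lambda>i. Inf (snd ` U i))"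
  have h: "(\<exists>x. (x, y) \<in> U i) \<longleftrightarrow> b i < y \<and> y < t i" "(x, y) \<in> closure (U i) \<Longrightarrow> b i \<le> y \<and> y \<le> t i" "b i < t i"
    if "i < m" for i x y
    using orthocell_height[OF cells[OF that]] unfolding t_def b_def by blast+
  define IT where "IT = {i. i < m \<and> t i \<in> G}"
  define IB where "IB = {i. i < m \<and> b i \<in> G}"
  define S where "S = (\<Union>i\<in>{..<m}. snd ` {p. reflex_point (U i) p})"
  have fin: "finite IT" "finite IB" "finite S"
    using cells by (auto simp: IT_def IB_def S_def orthocell_def)
  have "card S \<le> 2 * card {..<m}"
    unfolding S_def
    using cells by (intro card_UN_pairs_le) (auto simp: orthocell_def intro: order_trans[OF card_image_le])
  then have cS: "card S \<le> 2 * m" by simp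
  have "G \<subseteq> t ` IT \<union> b ` IB \<union> S"
  proof
    fix y assume y: "y \<in> G"
    obtain i where i: "i < m" "has_horizontal_segment (frontier (U i)) y"
      using exists_horizontal_segment[OF cells G(1) _ cov y] G by auto
    then obtain x where "(x, y) \<in> frontier (U i)"
      unfolding has_horizontal_segment_def by (meson less_imp_le order_refl)
    then have "b i \<le> y \<and> y \<le> t i" using h(2)[OF i(1)] by (auto simp: frontier_def)
    then consider "y = b i" | "y = t i" | "\<exists>x. (x, y) \<in> U i" using h(1)[OF i(1)] by fastforce
    then show "y \<in> t ` IT \<union> b ` IB \<union> S"
    proof cases
      case 3
      then obtain x where "reflex_point (U i) (x, y)"
        using exists_reflex_point cells[OF i(1)] i(2) unfolding orthocell_def by blast
      then show ?thesis using i(1) unfolding S_def by force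
    qed (use i y in \<open>auto simp: IT_def IB_def\<close>)
  qed
  then have "card G \<le> card (t ` IT \<union> b ` IB \<union> S)" using fin by (intro card_mono) auto
  also have "\<dots> \<le> card (t ` IT) + card (b ` IB) + card S"
    using card_Un_le[of "t ` IT \<union> b ` IB" S] card_Un_le[of "t ` IT" "b ` IB"] by linarith
  finally have c: "c \<le> card (t ` IT) + card (b ` IB)" using cS G(2) by linarith
  have T: "card (t ` IT) * (card (t ` IT) + 1) \<le> 2 * (\<Sum>i<m. card {y \<in> G. t i \<le> y})"
  proof -
    \<comment> \<open>Each distinct top level has at least as many grid rows at or above it as there
      are top levels there, which gives a triangular number. Cells sharing a top level only enlarge
      the sum over cells.\<close>
    have "(\<Sum>s\<in>t ` IT. card {y \<in> t ` IT. s \<le> y}) \<le> (\<Sum>s\<in>t ` IT. card {y \<in> G. s \<le> y})"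
      using G(1) by (intro sum_mono card_mono) (auto simp: IT_def)
    also have "\<dots> \<le> (\<Sum>i\<in>IT. card {y \<in> G. t i \<le> y})"
      using sum_image_le[OF fin(1), of "\<lambda>s. card {y \<in> G. s \<le> y}" t] by (simp add: o_def)
    also have "\<dots> \<le> (\<Sum>i<m. card {y \<in> G. t i \<le> y})"
      by (intro sum_mono2) (auto simp: IT_def)
    finally show ?thesis using sum_card_upper_set(1)[of "t ` IT"] fin by simp
  qed
  have B: "card (b ` IB) * (card (b ` IB) + 1) \<le> 2 * (\<Sum>i<m. card {y \<in> G. y \<le> b i})"
  proof -
    have "(\<Sum>s\<in>b ` IB. card {y \<in> b ` IB. y \<le> s}) \<le> (\<Sum>s\<in>b ` IB. card {y \<in> G. y \<le> s})"
      using G(1) by (intro sum_mono card_mono) (auto simp: IB_def)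
    also have "\<dots> \<le> (\<Sum>i\<in>IB. card {y \<in> G. y \<le> b i})"
      using sum_image_le[OF fin(2), of "\<lambda>s. card {y \<in> G. y \<le> s}" b] by (simp add: o_def)
    also have "\<dots> \<le> (\<Sum>i<m. card {y \<in> G. y \<le> b i})"
      by (intro sum_mono2) (auto simp: IB_def)
    finally show ?thesis using sum_card_upper_set(2)[of "b ` IB"] fin by simp
  qed
  \<comment> \<open>The three sets of rows are disjoint: the open cell meets only heights strictly
    between \<open>b i\<close> and \<open>t i\<close>, and \<open>b i < t i\<close>.\<close>
  have "card (rows_met G (U i)) + card {y \<in> G. t i \<le> y} + card {y \<in> G. y \<le> b i} \<le> 2 * m + c" if i: "i < m" for i
  proof -
    have "card (rows_met G (U i)) + card {y \<in> G. t i \<le> y} + card {y \<in> G. y \<le> b i} =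
      card (rows_met G (U i) \<union> {y \<in> G. t i \<le> y} \<union> {y \<in> G. y \<le> b i})"
      using G(1) h(1)[OF i] h(3)[OF i]
      by (subst card_Un_disjoint; (subst card_Un_disjoint)?) (auto simp: rows_met_def)
    also have "\<dots> \<le> card G" using G(1) by (intro card_mono) (auto simp: rows_met_def)
    finally show ?thesis using G(2) by simp
  qed
  then have "(\<Sum>i<m. card (rows_met G (U i)) + card {y \<in> G. t i \<le> y} + card {y \<in> G. y \<le> b i}) \<le> (\<Sum>i<m. 2 * m + c)"
    by (intro sum_mono) auto
  then have sum: "(\<Sum>i<m. card (rows_met G (U i))) + (\<Sum>i<m. card {y \<in> G. t i \<le> y}) +
      (\<Sum>i<m. card {y \<in> G. y \<le> b i}) \<le> m * (2 * m + c)"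
    by (simp add: sum.distrib)
  define p where "p = card (t ` IT)"
  define q where "q = card (b ` IB)"
  have "c * c + 2 * c \<le> (p + q) * (p + q) + 2 * (p + q)"
    using c by (intro add_mono mult_mono) (auto simp: p_def q_def)
  \<comment> \<open>For a fixed total \<open>p + q\<close> the two triangular numbers have the
    smallest sum when \<open>p = q\<close>, whence
    \<open>2 * (p * q) \<le> p * p + q * q\<close>.\<close>
  also have "\<dots> \<le> 2 * (p * (p + 1)) + 2 * (q * (q + 1))"
  proof -
    have "int (2 * (p * q)) \<le> int (p * p + q * q)"
      using zero_le_power2[of "int p - int q"] by (simp add: power2_eq_square algebra_simps)
    then have "2 * (p * q) \<le> p * p + q * q" by (simp only: of_nat_le_iff)
    then show ?thesis by (simp add: algebra_simps)
  qed
  finally show ?thesis using T B sum by (simp add: p_def q_def)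
qed

section \<open>Comparing the counts\<close>

text \<open>Eliminating \<open>R\<close> and \<open>Q\<close> cancels the mixed terms in
  \<open>m * c\<close> and leaves \<open>c * c + c \<le> 2 * (m * m) + 2 * m\<close>. Integrality
  gives \<open>3 * m + 1 \<le> 2 * c\<close>; its square, compared with four times that bound, is a
  contradiction.\<close>

lemma arithmetic_bound:
  fixes m c :: nat
  assumes "(2 * m + c) * (2 * m + c) \<le> 2 * R + 2 * Q + 4 * m"
    and "4 * R + c * c + 2 * c \<le> 4 * m * (2 * m + c)" "4 * Q + c * c + 2 * c \<le> 4 * m * (2 * m + c)"
    and "3 * m < 2 * c"
  shows False
proof -
  have "2 * (c * c) + 2 * c \<le> 4 * (m * m) + 4 * m"
    using assms(1-3) by (simp add: algebra_simps)
  moreover have "(3 * m + 1) * (3 * m + 1) \<le> (2 * c) * (2 * c)"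
    using assms(4) by (intro mult_mono) auto
  ultimately show False using assms(4) by (simp add: algebra_simps)
qed

theorem theorem24:
  fixes n m :: nat and C :: "nat \<Rightarrow> point set"
  assumes "n > 0" and "m > 0"
    and "\<And>i. i < m \<Longrightarrow> orthoconvex_curve (C i)"
    and "\<And>i. i < m \<Longrightarrow> finite (inner_corners (C i)) \<and> card (inner_corners (C i)) \<le> 2"
    and "covers (C ` {..<m}) (grid n)"
  shows "real m \<ge> 2 * real n / 7"
proof (rule ccontr)
  assume "\<not> ?thesis"
  then have lt: "7 * m < 2 * n" by linarith
  \<comment> \<open>With \<open>n = 2 * m + c\<close> the assumption \<open>7 * m < 2 * n\<close>
    becomes \<open>3 * m < 2 * c\<close>.\<close>
  define c where "c = n - 2 * m"
  have n: "n = 2 * m + c" "0 < c" "3 * m < 2 * c" using lt by (auto simp: c_def)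
  define U where "U = (\<lambda>i. inside (C i))"
  \<comment> \<open>Rows met by the swapped regions are columns met by the original ones.\<close>
  define V where "V = (\<lambda>i. prod.swap ` U i)"
  define G where "G = real ` {1..n}"
  have G: "finite G" "card G = 2 * m + c" and grid: "grid n = G \<times> G"
    using n by (auto simp: G_def grid_def card_image)
  have cell: "orthocell (U i)" and fr: "frontier (U i) = C i" if "i < m" for i
    using orthoconvex_curve_orthocell[of "C i"] assms(3,4) that by (auto simp: U_def)
  have cellV: "orthocell (V i)" and frV: "frontier (V i) = prod.swap ` C i" if "i < m" for i
    using cell[OF that] fr[OF that] by (auto simp: V_def orthocell_swap frontier_swap)
  have cov: "G \<times> G \<subseteq> (\<Union>i<m. frontier (U i))"
    using assms(5) fr unfolding covers_def grid by blast
  have covV: "G \<times> G \<subseteq> (\<Union>i<m. frontier (V i))"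
  proof
    fix p assume "p \<in> G \<times> G"
    then have "prod.swap p \<in> G \<times> G" by auto
    then have "prod.swap p \<in> (\<Union>i<m. frontier (U i))" by (rule subsetD[OF cov])
    then obtain i where i: "i < m" "prod.swap p \<in> frontier (U i)" by blast
    have "p \<in> frontier (V i)"
      unfolding V_def frontier_swap using imageI[OF i(2), of prod.swap] by simp
    then show "p \<in> (\<Union>i<m. frontier (V i))" using i(1) by blast
  qed
  have count: "card (frontier (U i) \<inter> G \<times> G) \<le> 2 * card (rows_met G (U i)) + 2 * card (rows_met G (V i)) + 4"
    if i: "i < m" for i
  proof -
    let ?t = "Sup (snd ` U i)" and ?b = "Inf (snd ` U i)"
    \<comment> \<open>The closure meets at most two rows more than the region, at its top and bottom
      level; this is the source of the summand 4.\<close>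
    have "{y \<in> G. \<exists>x. (x, y) \<in> closure (U i)} \<subseteq> rows_met G (U i) \<union> {?b, ?t}"
      using orthocell_height(1,2)[OF cell[OF i]] unfolding rows_met_def by force
    then have "card {y \<in> G. \<exists>x. (x, y) \<in> closure (U i)} \<le> card (rows_met G (U i) \<union> {?b, ?t})"
      using G by (intro card_mono) (auto simp: rows_met_def)
    also have "\<dots> \<le> card (rows_met G (U i)) + 2"
      using card_Un_le[of "rows_met G (U i)" "{?b, ?t}"] card_insert_le_m1[of 2 "{?t}" ?b] by simp
    finally have "card {y \<in> G. \<exists>x. (x, y) \<in> closure (U i)} \<le> card (rows_met G (U i)) + 2" .
    moreover have "{x \<in> G. \<exists>y. (x, y) \<in> U i} = rows_met G (V i)"
      by (auto simp: rows_met_def V_def)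
    ultimately show ?thesis
      using card_frontier_grid_le[of "U i" G] cell[OF i] G(1) by (simp add: orthocell_def)
  qed
  have "(2 * m + c) * (2 * m + c) = card (G \<times> G)" using G by (simp add: card_cartesian_product)
  also have "\<dots> \<le> card (\<Union>i<m. frontier (U i) \<inter> G \<times> G)"
    using cov G by (intro card_mono) auto
  also have "\<dots> \<le> (\<Sum>i<m. card (frontier (U i) \<inter> G \<times> G))"
    by (intro card_UN_le) auto
  also have "\<dots> \<le> (\<Sum>i<m. 2 * card (rows_met G (U i)) + 2 * card (rows_met G (V i)) + 4)"
    using count by (intro sum_mono) auto
  also have "\<dots> = 2 * (\<Sum>i<m. card (rows_met G (U i))) + 2 * (\<Sum>i<m. card (rows_met G (V i))) + 4 * m"
    by (simp add: sum.distrib sum_distrib_left)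
  finally show False
    using sum_card_rows_met_le[OF cell G n(2) cov] sum_card_rows_met_le[OF cellV G n(2) covV] n(3)
    by (rule arithmetic_bound)
qed

end
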